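(* Consider the nonparametric regression model $Y_n=f(X_n)+\varepsilon_n$, $n\ge 1$, where $(X_n)$ are i.i.d. real random variables with positive probability density function $g$. Assume the following: (1) the kernel $K:\mathbb{R}\to\mathbb{R}$ is a positive symmetric bounded function, differentiable with bounded derivative, satisfying $\int_{\mathbb{R}} K(x)\,dx=1$, $\int_{\mathbb{R}} K'(x)\,dx=0$, $\int_{\mathbb{R}} xK'(x)\,dx=-1$, $\int_{\mathbb{R}} x^2K'(x)\,dx=0$, $\int_{\mathbb{R}} x^4K(x)\,dx<\infty$ and $\int_{\mathbb{R}} x^4|K'(x)|\,dx<\infty$; (2) $f$ and $g$ are bounded continuous, twice differentiable with bounded derivatives; (3) the sequences $(\varepsilon_n)$ and $(X_n)$ are independent, and $(\varepsilon_n)$ is a sequence of independent, identically distributed, square integrable random variables with $\mathbb{E}[\varepsilon_n]=0$ and $\mathbb{E}[\varepsilon_n^2]=\sigma^2$. Let $h_n=n^{-\alpha}$ with $0<\alpha<1/3$. Then, for any $x\in\mathbb{R}$ such that $g(x)>0$, $$\lim_{n\to\infty}\widehat f_n^{\,\prime}(x)=f'(x)\quad\text{a.s.},\qquad \lim_{n\to\infty}\widetilde f_n^{\,\prime}(x)=f'(x)\quad\text{a.s.},\qquad \lim_{n\to\infty}\check f_n^{\,\prime}(x)=f'(x)\quad\text{a.s.},$$ where $\widehat f_n^{\,\prime}$, $\widetilde f_n^{\,\prime}$, $\check f_n^{\,\prime}$ are the three derivative estimators (built from $(X_k,Y_k)_{1\le k\le n}$, $K$ and $(h_k)$) defined in the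 context.
   Context: Given the observations $(X_k,Y_k)$, the kernel $K$ and the bandwidths $h_k>0$, define for $x\in\mathbb{R}$ $$\widehat h_n(x)=\frac1n\sum_{k=1}^n\frac{Y_k}{h_k}K\Big(\frac{x-X_k}{h_k}\Big),\qquad \widehat g_n(x)=\frac1n\sum_{k=1}^n\frac{1}{h_k}K\Big(\frac{x-X_k}{h_k}\Big).$$ (The function $\widehat h_n(x)$ is not to be confused with the bandwidth $h_n$.) Their derivatives in $x$ are $$\widehat h_n'(x)=\frac1n\sum_{k=1}^n\frac{Y_k}{h_k^2}K'\Big(\frac{x-X_k}{h_k}\Big),\qquad \widehat g_n^{\,\prime}(x)=\frac1n\sum_{k=1}^n\frac{1}{h_k^2}K'\Big(\frac{x-X_k}{h_k}\Big).$$ The three estimators of $f$ are: the recursive Nadaraya-Watson estimator $\widehat f_n(x)=\widehat h_n(x)/\widehat g_n(x)$; the estimator $\widetilde f_n(x)=\widehat h_n(x)/g(x)$; and $\check f_n(x)=\frac1n\sum_{k=1}^n\frac{Y_k}{g(X_k)h_k}K\big(\frac{x-X_k}{h_k}\big)$. Their derivatives are given, for $x$ with $g(x)>0$ (denominators being positive), by $$\widehat f_n^{\,\prime}(x)=\frac{\widehat h_n'(x)}{\widehat g_n(x)}-\frac{\widehat h_n(x)\,\widehat g_n^{\,\prime}(x)}{\widehat g_n(x)^2},\qquad \widetilde f_n^{\,\prime}(x)=\frac{\widehat h_n'(x)}{g(x)}-\frac{\widehat h_n(x)\,g'(x)}{g(x)^2},$$ $$\check f_n^{\,\prime}(x)=\frac1n\sum_{k=1}^n\frac{Y_k}{g(X_k)h_k^2}K'\Big(\frac{x-X_k}{h_k}\Big).$$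 *)

theory Defs
  imports "HOL-Probability.Probability"
begin

text \<open>
  Observations are indexed from 1. In the estimators below, \<open>X\<close> and \<open>Y\<close> are realised
  observation sequences (that is, the values of the random variables at one sample point),
  \<open>h\<close> is the bandwidth sequence, \<open>K\<close> the kernel and \<open>g\<close> the density of the design points.
\<close>

definition h_hat ::
  "(real \<Rightarrow> real) \<Rightarrow> (nat \<Rightarrow> real) \<Rightarrow> (nat \<Rightarrow> real) \<Rightarrow> (nat \<Rightarrow> real) \<Rightarrow> nat \<Rightarrow> real \<Rightarrow> real" where
  "h_hat K h X Y n x = (1 / real n) * (\<Sum>k=1..n. Y k / h k * K ((x - X k) / h k))"

definition g_hat ::
  "(real \<Rightarrow> real) \<Rightarrow> (nat \<Rightarrow> real) \<Rightarrow> (nat \<Rightarrow> real) \<Rightarrow> nat \<Rightarrow> real \<Rightarrow> real" where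
  "g_hat K h X n x = (1 / real n) * (\<Sum>k=1..n. 1 / h k * K ((x - X k) / h k))"

definition f_hat ::
  "(real \<Rightarrow> real) \<Rightarrow> (nat \<Rightarrow> real) \<Rightarrow> (nat \<Rightarrow> real) \<Rightarrow> (nat \<Rightarrow> real) \<Rightarrow> nat \<Rightarrow> real \<Rightarrow> real" where
  "f_hat K h X Y n x = h_hat K h X Y n x / g_hat K h X n x"

definition f_tilde ::
  "(real \<Rightarrow> real) \<Rightarrow> (real \<Rightarrow> real) \<Rightarrow> (nat \<Rightarrow> real) \<Rightarrow> (nat \<Rightarrow> real) \<Rightarrow> (nat \<Rightarrow> real) \<Rightarrow> nat \<Rightarrow> real \<Rightarrow> real"
  where
  "f_tilde g K h X Y n x = h_hat K h X Y n x / g x"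

definition f_check ::
  "(real \<Rightarrow> real) \<Rightarrow> (real \<Rightarrow> real) \<Rightarrow> (nat \<Rightarrow> real) \<Rightarrow> (nat \<Rightarrow> real) \<Rightarrow> (nat \<Rightarrow> real) \<Rightarrow> nat \<Rightarrow> real \<Rightarrow> real"
  where
  "f_check g K h X Y n x =
     (1 / real n) * (\<Sum>k=1..n. Y k / (g (X k) * h k) * K ((x - X k) / h k))"

definition h_hat' ::
  "(real \<Rightarrow> real) \<Rightarrow> (nat \<Rightarrow> real) \<Rightarrow> (nat \<Rightarrow> real) \<Rightarrow> (nat \<Rightarrow> real) \<Rightarrow> nat \<Rightarrow> real \<Rightarrow> real" where
  "h_hat' K h X Y n x =
     (1 / real n) * (\<Sum>k=1..n. Y k / (h k)\<^sup>2 * deriv K ((x - X k) / h k))"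

definition g_hat' ::
  "(real \<Rightarrow> real) \<Rightarrow> (nat \<Rightarrow> real) \<Rightarrow> (nat \<Rightarrow> real) \<Rightarrow> nat \<Rightarrow> real \<Rightarrow> real" where
  "g_hat' K h X n x =
     (1 / real n) * (\<Sum>k=1..n. 1 / (h k)\<^sup>2 * deriv K ((x - X k) / h k))"

definition f_hat' ::
  "(real \<Rightarrow> real) \<Rightarrow> (nat \<Rightarrow> real) \<Rightarrow> (nat \<Rightarrow> real) \<Rightarrow> (nat \<Rightarrow> real) \<Rightarrow> nat \<Rightarrow> real \<Rightarrow> real" where
  "f_hat' K h X Y n x =
     h_hat' K h X Y n x / g_hat K h X n x
     - h_hat K h X Y n x * g_hat' K h X n x / (g_hat K h X n x)\<^sup>2"

definition f_tilde' ::
  "(real \<Rightarrow> real) \<Rightarrow> (real \<Rightarrow> real) \<Rightarrow> (nat \<Rightarrow> real) \<Rightarrow> (nat \<Rightarrow> real) \<Rightarrow> (nat \<Rightarrow> real) \<Rightarrow> nat \<Rightarrow> real \<Rightarrow> real"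
  where
  "f_tilde' g K h X Y n x =
     h_hat' K h X Y n x / g x - h_hat K h X Y n x * deriv g x / (g x)\<^sup>2"

definition f_check' ::
  "(real \<Rightarrow> real) \<Rightarrow> (real \<Rightarrow> real) \<Rightarrow> (nat \<Rightarrow> real) \<Rightarrow> (nat \<Rightarrow> real) \<Rightarrow> (nat \<Rightarrow> real) \<Rightarrow> nat \<Rightarrow> real \<Rightarrow> real"
  where
  "f_check' g K h X Y n x =
     (1 / real n) * (\<Sum>k=1..n. Y k / (g (X k) * (h k)\<^sup>2) * deriv K ((x - X k) / h k))"

text \<open>The primed functions are the derivatives in \<open>x\<close> of the unprimed ones.\<close>

lemma kernel_term_deriv:
  fixes K :: "real \<Rightarrow> real"
  assumes "\<And>u. K differentiable (at u)" and "b > 0"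
  shows "((\<lambda>x. K ((x - c) / b)) has_real_derivative deriv K ((x - c) / b) / b) (at x)"
proof -
  have K: "(K has_real_derivative deriv K ((x - c) / b)) (at ((x - c) / b))"
    using assms(1) DERIV_deriv_iff_real_differentiable by blast
  have "((\<lambda>x. (x - c) / b) has_real_derivative 1 / b) (at x)"
    using assms(2) by (auto intro!: derivative_eq_intros)
  from DERIV_chain2[OF K this] show ?thesis by simp
qed

lemma kernel_sum_deriv:
  fixes K :: "real \<Rightarrow> real"
  assumes "\<And>u. K differentiable (at u)" and "\<And>k. k \<ge> 1 \<Longrightarrow> h k > 0"
  shows "((\<lambda>x. c * (\<Sum>k=1..n::nat. a k * K ((x - X k) / h k))) has_real_derivative
          c * (\<Sum>k=1..n. a k * (deriv K ((x - X k) / h k) / h k))) (at x)"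
  using assms
  by (intro DERIV_cmult DERIV_sum kernel_term_deriv) auto

lemma
  fixes K g :: "real \<Rightarrow> real"
  assumes K: "\<And>u. K differentiable (at u)" and h: "\<And>k. k \<ge> 1 \<Longrightarrow> h k > 0"
  shows h_hat_deriv: "(h_hat K h X Y n has_real_derivative h_hat' K h X Y n x) (at x)"
    and g_hat_deriv: "(g_hat K h X n has_real_derivative g_hat' K h X n x) (at x)"
    and f_check_deriv: "(f_check g K h X Y n has_real_derivative f_check' g K h X Y n x) (at x)"
    and f_hat_deriv: "g_hat K h X n x \<noteq> 0 \<Longrightarrow>
          (f_hat K h X Y n has_real_derivative f_hat' K h X Y n x) (at x)"
    and f_tilde_deriv: "g x \<noteq> 0 \<Longrightarrow> g differentiable (at x) \<Longrightarrow>
          (f_tilde g K h X Y n has_real_derivative f_tilde' g K h X Y n x) (at x)"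
proof -
  show hh: "(h_hat K h X Y n has_real_derivative h_hat' K h X Y n x) (at x)"
    using kernel_sum_deriv[OF K h, where c = "1 / real n" and n = n and a = "\<lambda>k. Y k / h k" and X = X and x = x]
    by (simp add: h_hat_def[abs_def] h_hat'_def power2_eq_square mult.assoc)
  show gg: "(g_hat K h X n has_real_derivative g_hat' K h X n x) (at x)"
    using kernel_sum_deriv[OF K h, where c = "1 / real n" and n = n and a = "\<lambda>k. 1 / h k" and X = X and x = x]
    by (simp add: g_hat_def[abs_def] g_hat'_def power2_eq_square mult.assoc)
  show "(f_check g K h X Y n has_real_derivative f_check' g K h X Y n x) (at x)"
    using kernel_sum_deriv[OF K h, where c = "1 / real n" and n = n and a = "\<lambda>k. Y k / (g (X k) * h k)" and X = X and x = x]
    by (simp add: f_check_def[abs_def] f_check'_def power2_eq_square mult.assoc)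
  show "(f_hat K h X Y n has_real_derivative f_hat' K h X Y n x) (at x)"
    if "g_hat K h X n x \<noteq> 0"
    using DERIV_divide[OF hh gg that] that
    by (simp add: f_hat_def[abs_def] f_hat'_def power2_eq_square diff_divide_distrib)
  show "(f_tilde g K h X Y n has_real_derivative f_tilde' g K h X Y n x) (at x)"
    if "g x \<noteq> 0" "g differentiable (at x)"
  proof -
    have "(g has_real_derivative deriv g x) (at x)"
      using that(2) DERIV_deriv_iff_real_differentiable by blast
    from DERIV_divide[OF hh this that(1)] show ?thesis
      using that(1)
      by (simp add: f_tilde_def[abs_def] f_tilde'_def power2_eq_square diff_divide_distrib)
  qed
qed

text \<open>Bounded and continuous, twice differentiable, with both derivatives bounded.
  The second derivative is not required to be continuous.\<close>

definition bounded_twice_differentiable :: "(real \<Rightarrow> real) \<Rightarrow> bool" where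
  "bounded_twice_differentiable \<phi> \<longleftrightarrow>
     bounded (range \<phi>) \<and> continuous_on UNIV \<phi> \<and>
     (\<forall>x. \<phi> differentiable (at x)) \<and> (\<forall>x. deriv \<phi> differentiable (at x)) \<and>
     bounded (range (deriv \<phi>)) \<and> bounded (range (deriv (deriv \<phi>)))"

text \<open>``Positive'' is read as nonnegative, for the kernel as for the density \<open>g\<close>: the
  consistency result is stated at those points where \<open>g\<close> does not vanish.\<close>

definition admissible_kernel :: "(real \<Rightarrow> real) \<Rightarrow> bool" where
  "admissible_kernel K \<longleftrightarrow>
     (\<forall>x. K x \<ge> 0) \<and> (\<forall>x. K (- x) = K x) \<and> bounded (range K) \<and>
     (\<forall>x. K differentiable (at x)) \<and> bounded (range (deriv K)) \<and>
     has_bochner_integral lborel K 1 \<and>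
     has_bochner_integral lborel (deriv K) 0 \<and>
     has_bochner_integral lborel (\<lambda>x. x * deriv K x) (-1) \<and>
     has_bochner_integral lborel (\<lambda>x. x\<^sup>2 * deriv K x) 0 \<and>
     integrable lborel (\<lambda>x. x ^ 4 * K x) \<and>
     integrable lborel (\<lambda>x. x ^ 4 * \<bar>deriv K x\<bar>)"

end

theory Submission
  imports Defs "HOL-Library.Discrete_Functions"
begin

text \<open>
  After writing \<open>Y k = f (X k) + \<epsilon> k\<close>, each estimator is a combination of averages of orthogonal
  summands whose second moments are at most of order \<open>h k powr (-3) = k powr (3 * \<alpha>)\<close>, because
  the squared weight \<open>(deriv K ((x - u) / b) / b^2)^2\<close> has integral of order \<open>b powr (-3)\<close>. As
  \<open>3 * \<alpha> < 1\<close>, the Rademacher--Menshov maximal inequality along powers of two shows that these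
  averages differ from the averages of their means by a null sequence almost surely.
  The means converge by dominated convergence: for bounded \<open>\<psi>\<close> differentiable at
  \<open>x\<close>, the quotient \<open>(\<psi> (x - b * v) - \<psi> x) / b\<close> is dominated by a multiple of \<open>\<bar>v\<bar>\<close> and tends to
  \<open>- v\<close> times the derivative of \<open>\<psi>\<close> at \<open>x\<close>. In \<open>f_check'\<close> the weight \<open>1 / g (X k)\<close> is unbounded away from
  \<open>x\<close>; there the fourth moment of \<open>deriv K\<close> makes the first moments of the summands of order
  \<open>(h k)^3\<close>, and Kronecker's lemma suffices.
\<close>

section \<open>Almost sure convergence of averages\<close>

lemma cesaro_mean_tendsto:
  fixes u :: "nat \<Rightarrow> real"
  assumes "u \<longlonglongrightarrow> l"
  shows "(\<lambda>n. (1 / real n) * (\<Sum>k=1..n. u k)) \<longlonglongrightarrow> l"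
proof (rule LIMSEQ_I)
  fix e :: real assume e: "0 < e"
  from LIMSEQ_D[OF assms, of "e/2"] e obtain N where
    N: "\<And>k. k \<ge> N \<Longrightarrow> \<bar>u k - l\<bar> < e / 2" by auto
  define C where "C = (\<Sum>k=1..N. \<bar>u k - l\<bar>)"
  have C0: "0 \<le> C" by (simp add: C_def sum_nonneg)
  \<comment> \<open>From \<open>n0\<close> on, the fixed contribution \<open>C\<close> of the first
    \<open>N\<close> deviations is below \<open>n * (e / 2)\<close>; the remaining deviations
    contribute at most \<open>e / 2\<close> each.\<close>
  obtain n0 :: nat where n0: "2 * C / e < real n0" using reals_Archimedean2 by blast
  show "\<exists>n0. \<forall>n\<ge>n0. norm ((1 / real n) * (\<Sum>k=1..n. u k) - l) < e"
  proof (intro exI allI impI)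
    fix n assume n: "max 1 n0 \<le> n"
    have "2 * C / e < real n" using n n0 by simp
    then have Cn: "C < real n * (e / 2)" using e by (simp add: field_simps)
    have "\<bar>u k - l\<bar> \<le> (if k \<in> {1..N} then \<bar>u k - l\<bar> else 0) + e / 2" if "k \<ge> 1" for k
      using N[of k] e that by (auto intro: less_imp_le)
    then have "(\<Sum>k=1..n. \<bar>u k - l\<bar>) \<le> (\<Sum>k=1..n. (if k \<in> {1..N} then \<bar>u k - l\<bar> else 0) + e / 2)"
      by (intro sum_mono) auto
    then have "(\<Sum>k=1..n. \<bar>u k - l\<bar>) \<le> (\<Sum>k=1..n. if k \<in> {1..N} then \<bar>u k - l\<bar> else 0) + n * (e / 2)"
      by (simp add: sum.distrib)
    also have "(\<Sum>k=1..n. if k \<in> {1..N} then \<bar>u k - l\<bar> else 0) = (\<Sum>k\<in>{1..n} \<inter> {1..N}. \<bar>u k - l\<bar>)"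
      by (rule sum.inter_restrict[symmetric]) simp
    also have "\<dots> \<le> C" unfolding C_def by (intro sum_mono2) auto
    finally have "(\<Sum>k=1..n. \<bar>u k - l\<bar>) < real n * e" using Cn by (simp add: field_simps)
    moreover have "(\<Sum>k=1..n. u k) - real n * l = (\<Sum>k=1..n. u k - l)"
      by (simp add: sum_subtractf)
    ultimately have "\<bar>(\<Sum>k=1..n. u k) - real n * l\<bar> < real n * e"
      using sum_abs[of "\<lambda>k. u k - l" "{1..n}"] by linarith
    moreover have "(1 / real n) * (\<Sum>k=1..n. u k) - l = ((\<Sum>k=1..n. u k) - real n * l) / real n"
      using n by (simp add: field_simps)
    ultimately show "norm ((1 / real n) * (\<Sum>k=1..n. u k) - l) < e"
      using n by (simp add: abs_divide divide_less_eq mult.commute)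
  qed
qed

text \<open>Summation by parts: the mean of the \<open>z k\<close> is a partial sum of the series
  minus the Cesaro mean of all earlier partial sums, and both converge to the sum of the
  series.\<close>

lemma kronecker_tendsto_0:
  fixes z :: "nat \<Rightarrow> real"
  assumes "summable (\<lambda>k. z k / real k)"
  shows "(\<lambda>n. (1 / real n) * (\<Sum>k=1..n. z k)) \<longlonglongrightarrow> 0"
proof -
  \<comment> \<open>The range starts at 0 to fit \<open>summable\<close>; the term at 0 is a
    division by zero and equals 0. Since \<open>t n\<close> stops before \<open>n\<close>, the term
    \<open>z n / n\<close> first enters in \<open>t (Suc n)\<close>.\<close>
  define t where "t n = (\<Sum>k<n. z k / real k)" for n
  have t: "t \<longlonglongrightarrow> (\<Sum>k. z k / real k)"
    unfolding t_def by (rule summable_LIMSEQ[OF assms])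
  have "(\<Sum>k=1..n. z k) = real n * t (Suc n) - (\<Sum>k=1..n. t k)" for n
  proof (induction n)
    case (Suc n)
    have "t (Suc (Suc n)) = t (Suc n) + z (Suc n) / real (Suc n)" by (simp add: t_def)
    then have "real (Suc n) * t (Suc (Suc n)) = real n * t (Suc n) + t (Suc n) + z (Suc n)"
      by (simp add: distrib_left) (simp add: algebra_simps)
    then show ?case using Suc by simp
  qed simp
  then have eq: "t (Suc n) - (1 / real n) * (\<Sum>k=1..n. t k) = (1 / real n) * (\<Sum>k=1..n. z k)" if "n \<ge> 1" for n
    using that by (simp add: right_diff_distrib)
  have "(\<lambda>n. t (Suc n) - (1 / real n) * (\<Sum>k=1..n. t k)) \<longlonglongrightarrow> 0"
    using tendsto_diff[OF LIMSEQ_Suc[OF t] cesaro_mean_tendsto[OF t]] by simp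
  then show ?thesis
    by (rule Lim_transform_eventually) (auto intro!: eventually_sequentiallyI[of 1] simp only: eq)
qed

text \<open>Monotone convergence exchanges sum and integral, so the random series has finite
  expectation and is therefore finite almost everywhere.\<close>

lemma AE_summable_of_summable_integral:
  fixes R :: "nat \<Rightarrow> 'a \<Rightarrow> real"
  assumes [measurable]: "\<And>j. integrable M (R j)" and nonneg: "\<And>j \<omega>. 0 \<le> R j \<omega>"
    and sum: "summable (\<lambda>j. \<integral>\<omega>. R j \<omega> \<partial>M)"
  shows "AE \<omega> in M. summable (\<lambda>j. R j \<omega>)"
proof -
  have [measurable]: "R j \<in> borel_measurable M" for j using assms(1) by simp
  have "(\<integral>\<^sup>+\<omega>. (\<Sum>j. ennreal (R j \<omega>)) \<partial>M) = (\<Sum>j. \<integral>\<^sup>+\<omega>. ennreal (R j \<omega>) \<partial>M)"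
    by (rule nn_integral_suminf) simp
  also have "\<dots> = (\<Sum>j. ennreal (\<integral>\<omega>. R j \<omega> \<partial>M))"
    by (intro suminf_cong nn_integral_eq_integral assms) (simp add: nonneg)
  finally have "(\<integral>\<^sup>+\<omega>. (\<Sum>j. ennreal (R j \<omega>)) \<partial>M) \<noteq> \<infinity>"
    using ennreal_suminf_neq_top[OF sum Bochner_Integration.integral_nonneg[OF nonneg]] by (simp only: infinity_ennreal_def not_False_eq_True)
  then have "AE \<omega> in M. (\<Sum>j. ennreal (R j \<omega>)) \<noteq> \<infinity>"
    by (intro nn_integral_noteq_infinite) auto
  then show ?thesis
    by eventually_elim (rule summable_suminf_not_top, auto simp: nonneg)
qed

text \<open>The sum of the squared increments of \<open>S\<close> over all dyadic subintervals, at
  all levels, of the interval from \<open>a\<close> to \<open>a + 2 ^ r\<close>. It dominates every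
  increment from \<open>a\<close> inside that interval up to a factor linear in \<open>r\<close>,
  while its expectation stays computable.\<close>

primrec dyadic_variation :: "(nat \<Rightarrow> real) \<Rightarrow> nat \<Rightarrow> nat \<Rightarrow> real" where
  "dyadic_variation S 0 a = (S (a + 1) - S a)\<^sup>2"
| "dyadic_variation S (Suc r) a = (S (a + 2 ^ Suc r) - S a)\<^sup>2
     + dyadic_variation S r a + dyadic_variation S r (a + 2 ^ r)"

lemma dyadic_variation_nonneg: "0 \<le> dyadic_variation S r a"
  by (induction r arbitrary: a) auto

lemma increment_le_dyadic_variation:
  "(S (a + 2 ^ r) - S a)\<^sup>2 \<le> dyadic_variation S r a"
  by (cases r) (auto simp: dyadic_variation_nonneg)

text \<open>Young's inequality with a free weight: the defect is a perfect square over
  \<open>c\<close>. The weight is tuned to the level during chaining, so that constants add up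
  instead of doubling at each level.\<close>

lemma square_add_le_weighted:
  fixes A B c :: real
  assumes "c > 0"
  shows "(A + B)\<^sup>2 \<le> (1 + c) * (A\<^sup>2 + B\<^sup>2 / c)"
proof -
  have "(1 + c) * (A\<^sup>2 + B\<^sup>2 / c) - (A + B)\<^sup>2 = (c * A - B)\<^sup>2 / c"
    using assms by (simp add: field_simps power2_eq_square)
  also have "\<dots> \<ge> 0" using assms by simp
  finally show ?thesis by simp
qed

text \<open>The chaining step of the Rademacher--Menshov inequality: a path to any \<open>m\<close> uses at most
  one dyadic interval per level.\<close>

lemma square_increment_le_dyadic_variation:
  assumes "m \<le> 2 ^ r"
  shows "(S (a + m) - S a)\<^sup>2 \<le> real (Suc r) * dyadic_variation S r a"
  using assms
proof (induction r arbitrary: a m)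
  case 0
  then show ?case by (cases m) auto
next
  case (Suc r)
  let ?D = "dyadic_variation S"
  show ?case
  proof (cases "m \<le> 2 ^ r")
    case True
    have "(S (a + m) - S a)\<^sup>2 \<le> real (Suc r) * ?D r a" by (rule Suc.IH[OF True])
    also have "\<dots> \<le> real (Suc (Suc r)) * ?D (Suc r) a"
      by (intro mult_mono) (auto simp: dyadic_variation_nonneg)
    finally show ?thesis .
  next
    case False
    define m' where "m' = m - 2 ^ r"
    have m: "m = 2 ^ r + m'" "m' \<le> 2 ^ r" using False Suc.prems by (auto simp: m'_def)
    define A where "A = S (a + 2 ^ r) - S a"
    define B where "B = S (a + 2 ^ r + m') - S (a + 2 ^ r)"
    \<comment> \<open>Taking the weight \<open>c = Suc r\<close> cancels the factor of the induction
      hypothesis in the right half, and the overall factor \<open>1 + c\<close> is exactly the one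
      wanted at the next level.\<close>
    have B: "B\<^sup>2 / real (Suc r) \<le> ?D r (a + 2 ^ r)"
      using Suc.IH[OF m(2), of "a + 2 ^ r"] by (simp add: B_def field_simps)
    have A: "A\<^sup>2 \<le> ?D r a" unfolding A_def by (rule increment_le_dyadic_variation)
    have "(S (a + m) - S a)\<^sup>2 = (A + B)\<^sup>2" by (simp add: A_def B_def m add.assoc)
    also have "\<dots> \<le> (1 + real (Suc r)) * (A\<^sup>2 + B\<^sup>2 / real (Suc r))"
      by (rule square_add_le_weighted) simp
    also have "\<dots> \<le> (1 + real (Suc r)) * ?D (Suc r) a"
    proof (intro mult_left_mono)
      have "0 \<le> (S (a + 2 ^ Suc r) - S a)\<^sup>2" by simp
      then show "A\<^sup>2 + B\<^sup>2 / real (Suc r) \<le> ?D (Suc r) a"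
        using A B unfolding dyadic_variation.simps by linarith
    qed simp
    finally show ?thesis by (simp add: add.commute)
  qed
qed

text \<open>The expectations of \<open>\<bar>Z k\<bar> / k\<close> are of order
  \<open>k powr (- b - 1)\<close>, which is summable. Hence the series of \<open>Z k / k\<close>
  converges absolutely almost surely, and Kronecker's lemma applies.\<close>

lemma mean_tendsto_0_AE_of_first_moments:
  fixes Z :: "nat \<Rightarrow> 'a \<Rightarrow> real"
  assumes int: "\<And>k. k \<ge> 1 \<Longrightarrow> integrable M (Z k)"
    and b: "0 < b" and bound: "\<And>k. k \<ge> 1 \<Longrightarrow> (\<integral>\<omega>. \<bar>Z k \<omega>\<bar> \<partial>M) \<le> C * real k powr (- b)"
  shows "AE \<omega> in M. (\<lambda>n. (1 / real n) * (\<Sum>k=1..n. Z k \<omega>)) \<longlonglongrightarrow> 0"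
proof -
  define R where "R k \<omega> = \<bar>Z k \<omega> / real k\<bar>" for k \<omega>
  \<comment> \<open>At index 0 the quotient is 0 by the convention on division, so integrability of
    \<open>Z 0\<close> does not enter.\<close>
  have intR: "integrable M (R k)" for k
    using int[of k] unfolding R_def[abs_def] by (cases "k = 0") auto
  have "summable (\<lambda>k. C * real k powr (- b - 1))"
    using b by (intro summable_mult) (simp add: summable_real_powr_iff)
  then have "summable (\<lambda>k. \<integral>\<omega>. R k \<omega> \<partial>M)"
  proof (rule summable_comparison_test'[where N = 1])
    fix k :: nat assume k: "1 \<le> k"
    have "(\<integral>\<omega>. R k \<omega> \<partial>M) = (\<integral>\<omega>. \<bar>Z k \<omega>\<bar> \<partial>M) / real k"
      unfolding R_def by (simp add: abs_divide)
    also have "\<dots> \<le> C * real k powr (- b) / real k"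
      using bound[OF k] by (simp add: divide_right_mono)
    also have "\<dots> = C * real k powr (- b - 1)"
      using k by (simp add: powr_diff)
    finally show "norm (\<integral>\<omega>. R k \<omega> \<partial>M) \<le> C * real k powr (- b - 1)"
      by (simp add: R_def)
  qed
  from AE_summable_of_summable_integral[OF intR _ this] have "AE \<omega> in M. summable (\<lambda>k. R k \<omega>)"
    by (simp add: R_def)
  then show ?thesis
  proof eventually_elim
    fix \<omega> assume "summable (\<lambda>k. R k \<omega>)"
    then have "summable (\<lambda>k. Z k \<omega> / real k)" unfolding R_def by (rule summable_rabs_cancel)
    then show "(\<lambda>n. (1 / real n) * (\<Sum>k=1..n. Z k \<omega>)) \<longlonglongrightarrow> 0" by (rule kronecker_tendsto_0)
  qed
qed

text \<open>The dyadic argument uses second moments only, so orthogonality in L2 is the part of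
  independence that is extracted; both the centred design terms and the noise terms provide
  it.\<close>

locale orthogonal_sequence =
  fixes M :: "'a measure" and W :: "nat \<Rightarrow> 'a \<Rightarrow> real"
  assumes W_measurable [measurable]: "\<And>k. k \<ge> 1 \<Longrightarrow> W k \<in> borel_measurable M"
    and W_square_integrable: "\<And>k. k \<ge> 1 \<Longrightarrow> integrable M (\<lambda>\<omega>. (W k \<omega>)\<^sup>2)"
    and W_orthogonal: "\<And>i j. i \<ge> 1 \<Longrightarrow> j \<ge> 1 \<Longrightarrow> i \<noteq> j \<Longrightarrow> (\<integral>\<omega>. W i \<omega> * W j \<omega> \<partial>M) = 0"
begin

lemma integrable_mult:
  assumes "i \<ge> 1" "j \<ge> 1" shows "integrable M (\<lambda>\<omega>. W i \<omega> * W j \<omega>)"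
proof (rule Bochner_Integration.integrable_bound)
  show "integrable M (\<lambda>\<omega>. (W i \<omega>)\<^sup>2 + (W j \<omega>)\<^sup>2)"
    using assms by (intro Bochner_Integration.integrable_add W_square_integrable)
  show "(\<lambda>\<omega>. W i \<omega> * W j \<omega>) \<in> borel_measurable M" using assms by simp
  have "\<bar>x * y\<bar> \<le> \<bar>x\<^sup>2 + y\<^sup>2\<bar>" for x y :: real
    using sum_squares_bound[of "\<bar>x\<bar>" "\<bar>y\<bar>"] mult_nonneg_nonneg[of "\<bar>x\<bar>" "\<bar>y\<bar>"]
    by (simp add: abs_mult del: mult_nonneg_nonneg)
  then show "AE \<omega> in M. norm (W i \<omega> * W j \<omega>) \<le> norm ((W i \<omega>)\<^sup>2 + (W j \<omega>)\<^sup>2)" by simp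
qed

text \<open>Pythagoras in L2: the off-diagonal products of the expanded square integrate to 0.
  Excluding index 0 from \<open>A\<close> keeps it within the range of the locale
  assumptions.\<close>

lemma sum_square_integral:
  assumes "finite A" "0 \<notin> A"
  shows "integrable M (\<lambda>\<omega>. (\<Sum>k\<in>A. W k \<omega>)\<^sup>2)"
    and "(\<integral>\<omega>. (\<Sum>k\<in>A. W k \<omega>)\<^sup>2 \<partial>M) = (\<Sum>k\<in>A. \<integral>\<omega>. (W k \<omega>)\<^sup>2 \<partial>M)"
proof -
  have pos: "k \<ge> 1" if "k \<in> A" for k using that assms(2) by (cases k) auto
  have eq: "(\<Sum>k\<in>A. W k \<omega>)\<^sup>2 = (\<Sum>i\<in>A. \<Sum>j\<in>A. W i \<omega> * W j \<omega>)" for \<omega>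
    by (simp add: power2_eq_square sum_product)
  show "integrable M (\<lambda>\<omega>. (\<Sum>k\<in>A. W k \<omega>)\<^sup>2)"
    unfolding eq by (intro Bochner_Integration.integrable_sum integrable_mult pos)
  have "(\<integral>\<omega>. (\<Sum>k\<in>A. W k \<omega>)\<^sup>2 \<partial>M) = (\<Sum>i\<in>A. \<Sum>j\<in>A. \<integral>\<omega>. W i \<omega> * W j \<omega> \<partial>M)"
  proof -
    have "(\<integral>\<omega>. (\<Sum>j\<in>A. W i \<omega> * W j \<omega>) \<partial>M) = (\<Sum>j\<in>A. \<integral>\<omega>. W i \<omega> * W j \<omega> \<partial>M)" if "i \<in> A" for i
      using that by (intro Bochner_Integration.integral_sum integrable_mult pos)
    moreover have "(\<integral>\<omega>. (\<Sum>i\<in>A. \<Sum>j\<in>A. W i \<omega> * W j \<omega>) \<partial>M) = (\<Sum>i\<in>A. \<integral>\<omega>. (\<Sum>j\<in>A. W i \<omega> * W j \<omega>) \<partial>M)"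
      by (intro Bochner_Integration.integral_sum Bochner_Integration.integrable_sum integrable_mult pos)
    ultimately show ?thesis unfolding eq by simp
  qed
  also have "\<dots> = (\<Sum>i\<in>A. \<Sum>j\<in>A. if j = i then \<integral>\<omega>. (W i \<omega>)\<^sup>2 \<partial>M else 0)"
    by (intro sum.cong refl) (auto intro: W_orthogonal dest: pos simp: power2_eq_square)
  finally show "(\<integral>\<omega>. (\<Sum>k\<in>A. W k \<omega>)\<^sup>2 \<partial>M) = (\<Sum>k\<in>A. \<integral>\<omega>. (W k \<omega>)\<^sup>2 \<partial>M)"
    using assms(1) by simp
qed

lemma increment_eq_sum:
  "(\<Sum>k=1..a + m. W k \<omega>) - (\<Sum>k=1..a. W k \<omega>) = (\<Sum>k\<in>{a<..a + m}. W k \<omega>)"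
proof -
  have "{1..a + m} = {1..a} \<union> {a<..a + m}" by auto
  moreover have "sum (\<lambda>k. W k \<omega>) ({1..a} \<union> {a<..a + m}) = sum (\<lambda>k. W k \<omega>) {1..a} + sum (\<lambda>k. W k \<omega>) {a<..a + m}"
    by (rule sum.union_disjoint) auto
  ultimately show ?thesis by simp
qed

lemma increment_square_integral:
  "integrable M (\<lambda>\<omega>. ((\<Sum>k=1..a + m. W k \<omega>) - (\<Sum>k=1..a. W k \<omega>))\<^sup>2)"
  "(\<integral>\<omega>. ((\<Sum>k=1..a + m. W k \<omega>) - (\<Sum>k=1..a. W k \<omega>))\<^sup>2 \<partial>M) = (\<Sum>k\<in>{a<..a + m}. \<integral>\<omega>. (W k \<omega>)\<^sup>2 \<partial>M)"
  unfolding increment_eq_sum by (rule sum_square_integral; simp)+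

lemma dyadic_variation_integrable:
  "integrable M (\<lambda>\<omega>. dyadic_variation (\<lambda>n. \<Sum>k=1..n. W k \<omega>) r a)"
proof (induction r arbitrary: a)
  case 0
  show ?case unfolding dyadic_variation.simps by (rule increment_square_integral)
next
  case (Suc r)
  show ?case unfolding dyadic_variation.simps
    by (intro Bochner_Integration.integrable_add Suc.IH increment_square_integral)
qed

text \<open>Each level partitions the interval, so by Pythagoras it contributes the full sum of
  second moments; there are \<open>Suc r\<close> levels.\<close>

lemma dyadic_variation_integral:
  "(\<integral>\<omega>. dyadic_variation (\<lambda>n. \<Sum>k=1..n. W k \<omega>) r a \<partial>M) =
     real (Suc r) * (\<Sum>k\<in>{a<..a + 2 ^ r}. \<integral>\<omega>. (W k \<omega>)\<^sup>2 \<partial>M)"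
proof (induction r arbitrary: a)
  case 0
  show ?case by (simp only: dyadic_variation.simps increment_square_integral) simp
next
  case (Suc r)
  let ?E = "\<lambda>A. \<Sum>k\<in>A. \<integral>\<omega>. (W k \<omega>)\<^sup>2 \<partial>M"
  have "{a<..a + 2 ^ Suc r} = {a<..a + 2 ^ r} \<union> {a + 2 ^ r<..a + 2 ^ r + 2 ^ r}" by auto
  moreover have "?E ({a<..a + 2 ^ r} \<union> {a + 2 ^ r<..a + 2 ^ r + 2 ^ r}) =
      ?E {a<..a + 2 ^ r} + ?E {a + 2 ^ r<..a + 2 ^ r + 2 ^ r}"
    by (rule sum.union_disjoint) auto
  ultimately have split: "?E {a<..a + 2 ^ Suc r} =
      ?E {a<..a + 2 ^ r} + ?E {a + 2 ^ r<..a + 2 ^ r + 2 ^ r}" by (simp only:)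
  have "(\<integral>\<omega>. dyadic_variation (\<lambda>n. \<Sum>k=1..n. W k \<omega>) (Suc r) a \<partial>M) = ?E {a<..a + 2 ^ Suc r}
      + real (Suc r) * ?E {a<..a + 2 ^ r} + real (Suc r) * ?E {a + 2 ^ r<..a + 2 ^ r + 2 ^ r}"
    by (simp only: dyadic_variation.simps Bochner_Integration.integral_add
        Bochner_Integration.integrable_add increment_square_integral dyadic_variation_integrable Suc.IH)
  also have "\<dots> = real (Suc (Suc r)) * ?E {a<..a + 2 ^ Suc r}"
    unfolding split of_nat_Suc[of "Suc r"] by (simp only: distrib_left distrib_right mult_1)
  finally show ?case .
qed

text \<open>The chaining bound controls all partial sums up to \<open>2 ^ r\<close> by one variable,
  which divided by \<open>4 ^ r\<close> is \<open>R r\<close>. Its expectation is of order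
  \<open>(r + 1)^2 * 2 powr ((b - 1) * r)\<close>, summable as \<open>b < 1\<close>, so
  \<open>R r\<close> tends to 0 almost surely. Every \<open>n\<close> lies within a factor 2 of a
  power of two, which bounds the squared mean at \<open>n\<close> by four times such an
  \<open>R r\<close>.\<close>

theorem mean_tendsto_0_AE:
  assumes "0 \<le> b" "b < 1" and var: "\<And>k. k \<ge> 1 \<Longrightarrow> (\<integral>\<omega>. (W k \<omega>)\<^sup>2 \<partial>M) \<le> C * real k powr b"
  shows "AE \<omega> in M. (\<lambda>n. (1 / real n) * (\<Sum>k=1..n. W k \<omega>)) \<longlonglongrightarrow> 0"
proof -
  define S where "S \<omega> n = (\<Sum>k=1..n. W k \<omega>)" for \<omega> n
  define R where "R r \<omega> = real (Suc r) / 4 ^ r * dyadic_variation (S \<omega>) r 0" for r \<omega>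
  \<comment> \<open>The fourth root of the geometric ratio \<open>2 powr b / 2\<close>. Two of the
    four factors \<open>q ^ r\<close> tame the square of \<open>Suc r\<close>, and the other two
    leave a convergent geometric series.\<close>
  define q where "q = 2 powr ((b - 1) / 4)"
  have q: "0 < q" "q < 1" using assms(2) by (auto simp: q_def powr_less_one)
  have q4: "q ^ 4 = 2 powr b / 2"
  proof -
    define c where "c = (b - 1) / 4"
    have b: "b = c + c + c + c + 1" unfolding c_def by (simp add: field_simps)
    show ?thesis unfolding q_def c_def[symmetric] b powr_add by (simp add: power4_eq_xxxx)
  qed
  \<comment> \<open>At \<open>k = 1\<close> the bound reads second moment \<le> \<open>C\<close>,
    which forces the sign.\<close>
  have C: "0 \<le> C"
    by (rule order_trans[OF _ var[of 1, simplified]]) simp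
  have R0: "0 \<le> R r \<omega>" for r \<omega> by (simp add: R_def dyadic_variation_nonneg)
  have intR: "integrable M (R r)" for r
    unfolding R_def[abs_def] S_def[abs_def] by (intro integrable_mult_right dyadic_variation_integrable)
  have R_le: "(\<integral>\<omega>. R r \<omega> \<partial>M) \<le> C * (real (Suc r) * q ^ r)\<^sup>2 * (q\<^sup>2) ^ r" for r
  proof -
    have "(\<Sum>k\<in>{0<..0 + 2 ^ r}. \<integral>\<omega>. (W k \<omega>)\<^sup>2 \<partial>M) \<le> (\<Sum>k\<in>{0<..2 ^ r::nat}. C * (2 ^ r) powr b)"
      unfolding add_0
    proof (rule sum_mono)
      fix k :: nat assume k: "k \<in> {0<..2 ^ r}"
      have "real k \<le> 2 ^ r" using k by (metis greaterThanAtMost_iff of_nat_le_iff of_nat_numeral of_nat_power)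
      then have "real k powr b \<le> (2 ^ r) powr b" by (intro powr_mono2 assms) auto
      then show "(\<integral>\<omega>. (W k \<omega>)\<^sup>2 \<partial>M) \<le> C * (2 ^ r) powr b"
        using var[of k] k mult_left_mono[OF _ C] by (force intro: order_trans)
    qed
    also have "\<dots> = C * 2 ^ r * (2 ^ r) powr b" by simp
    also have "(2 ^ r) powr b = (2 powr b) ^ r"
      using powr_realpow[of 2 r] powr_realpow[of "2 powr b" r]
      by (metis mult.commute powr_gt_zero powr_powr zero_less_numeral)
    finally have le: "(\<Sum>k\<in>{0<..0 + 2 ^ r}. \<integral>\<omega>. (W k \<omega>)\<^sup>2 \<partial>M) \<le> C * 2 ^ r * (2 powr b) ^ r" .
    have "(\<integral>\<omega>. R r \<omega> \<partial>M) = real (Suc r) / 4 ^ r * (real (Suc r) * (\<Sum>k\<in>{0<..0 + 2 ^ r}. \<integral>\<omega>. (W k \<omega>)\<^sup>2 \<partial>M))"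
      unfolding R_def S_def by (simp only: integral_mult_right_zero dyadic_variation_integral)
    also have "\<dots> \<le> real (Suc r) / 4 ^ r * (real (Suc r) * (C * 2 ^ r * (2 powr b) ^ r))"
      by (intro mult_left_mono le) auto
    also have "\<dots> = C * (real (Suc r))\<^sup>2 * (2 powr b / 2) ^ r"
    proof -
      have "(4::real) ^ r = 2 ^ r * 2 ^ r" by (simp flip: power_mult_distrib)
      then show ?thesis by (simp add: power_divide power2_eq_square field_simps)
    qed
    also have "\<dots> = C * (real (Suc r) * q ^ r)\<^sup>2 * (q\<^sup>2) ^ r"
      unfolding q4[symmetric]
      by (simp add: power_mult_distrib flip: power_mult power_add)
    finally show ?thesis .
  qed
  have "(\<lambda>r. real (Suc r) * q ^ r) \<longlonglongrightarrow> 0"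
    using tendsto_add[OF powser_times_n_limit_0[of q] LIMSEQ_realpow_zero[of q]] q
    by (simp add: algebra_simps)
  then have "Bseq (\<lambda>r. real (Suc r) * q ^ r)" by (intro convergent_imp_Bseq convergentI)
  then obtain B where B: "\<And>r. norm (real (Suc r) * q ^ r) \<le> B" unfolding Bseq_def by blast
  have "summable (\<lambda>r. C * B\<^sup>2 * (q\<^sup>2) ^ r)"
    using q by (intro summable_mult summable_geometric) (auto simp: power_less_one_iff)
  then have "summable (\<lambda>r. \<integral>\<omega>. R r \<omega> \<partial>M)"
  proof (rule summable_comparison_test'[where N = 0])
    fix r
    have "(real (Suc r) * q ^ r)\<^sup>2 \<le> B\<^sup>2"
      using B[of r] q by (intro power_mono) auto
    then have "C * (real (Suc r) * q ^ r)\<^sup>2 * (q\<^sup>2) ^ r \<le> C * B\<^sup>2 * (q\<^sup>2) ^ r"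
      using C by (intro mult_right_mono mult_left_mono) auto
    then show "norm (\<integral>\<omega>. R r \<omega> \<partial>M) \<le> C * B\<^sup>2 * (q\<^sup>2) ^ r"
      using R_le[of r] Bochner_Integration.integral_nonneg[of M "R r"] R0 by simp
  qed
  from AE_summable_of_summable_integral[OF intR R0 this] show ?thesis
  proof eventually_elim
    fix \<omega> assume "summable (\<lambda>r. R r \<omega>)"
    then have lim: "(\<lambda>r. R r \<omega>) \<longlonglongrightarrow> 0" by (rule summable_LIMSEQ_zero)
    \<comment> \<open>The exponent of the first power of two strictly above \<open>n\<close>; it
      exceeds \<open>n\<close> by a factor of at most 2, which is the origin of the constant 4
      below.\<close>
    define \<rho> where "\<rho> n = Suc (floor_log n)" for n
    have \<rho>: "n < 2 ^ \<rho> n" "n \<ge> 1 \<Longrightarrow> 2 ^ \<rho> n \<le> 2 * n" for n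
      using floor_log_exp2_gt[of n] floor_log_exp2_le[of n] by (auto simp: \<rho>_def)
    have "filterlim \<rho> at_top sequentially"
      unfolding filterlim_at_top
    proof
      fix Z
      show "\<forall>\<^sub>F n in sequentially. Z \<le> \<rho> n"
      proof (rule eventually_sequentiallyI)
        fix n :: nat assume "2 ^ Z \<le> n"
        then have "(2::nat) ^ Z < 2 ^ \<rho> n" using \<rho>(1)[of n] by linarith
        then show "Z \<le> \<rho> n" by simp
      qed
    qed
    from filterlim_compose[OF lim this] have "(\<lambda>n. 4 * R (\<rho> n) \<omega>) \<longlonglongrightarrow> 0"
      using tendsto_mult_right_zero by blast
    then have "(\<lambda>n. ((1 / real n) * S \<omega> n)\<^sup>2) \<longlonglongrightarrow> 0"
    proof (rule tendsto_sandwich[OF _ _ tendsto_const, rotated 2])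
      show "\<forall>\<^sub>F n in sequentially. ((1 / real n) * S \<omega> n)\<^sup>2 \<le> 4 * R (\<rho> n) \<omega>"
      proof (rule eventually_sequentiallyI)
        fix n :: nat assume n: "1 \<le> n"
        \<comment> \<open>The dyadic interval starts at 0, where the partial sum is empty, so the
          increment is the partial sum itself.\<close>
        have "(S \<omega> (0 + n) - S \<omega> 0)\<^sup>2 \<le> real (Suc (\<rho> n)) * dyadic_variation (S \<omega>) (\<rho> n) 0"
          using \<rho>(1)[of n] by (intro square_increment_le_dyadic_variation) simp
        also have "\<dots> = (2 ^ \<rho> n)\<^sup>2 * R (\<rho> n) \<omega>"
        proof -
          have "((2::real) ^ \<rho> n)\<^sup>2 = 4 ^ \<rho> n" by (simp add: power2_eq_square flip: power_mult_distrib)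
          then show ?thesis by (simp add: R_def)
        qed
        also have "\<dots> \<le> (2 * real n)\<^sup>2 * R (\<rho> n) \<omega>"
        proof (intro mult_right_mono power_mono R0)
          show "2 ^ \<rho> n \<le> 2 * real n"
            using \<rho>(2)[OF n] by (metis of_nat_le_iff of_nat_mult of_nat_numeral of_nat_power)
        qed auto
        finally have "(S \<omega> n)\<^sup>2 \<le> 4 * R (\<rho> n) \<omega> * (real n)\<^sup>2"
          by (simp add: S_def power_mult_distrib mult_ac)
        then show "((1 / real n) * S \<omega> n)\<^sup>2 \<le> 4 * R (\<rho> n) \<omega>"
          using n by (simp add: power_divide divide_le_eq)
      qed
    qed auto
    from tendsto_real_sqrt[OF this] show "(\<lambda>n. (1 / real n) * (\<Sum>k=1..n. W k \<omega>)) \<longlonglongrightarrow> 0"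
      unfolding S_def real_sqrt_abs real_sqrt_zero by (rule tendsto_rabs_zero_cancel)
  qed
qed

end

section \<open>Kernel integrals\<close>

lemma kernel_substitution:
  fixes F :: "real \<Rightarrow> real"
  assumes "b > 0"
  shows "(\<integral>u. F u \<partial>lborel) = b * (\<integral>v. F (x - b * v) \<partial>lborel)"
  using lborel_integral_real_affine[of "- b" F x] assms by simp

lemma integrable_kernel_affine:
  fixes L :: "real \<Rightarrow> real"
  assumes "integrable lborel L" "b > 0"
  shows "integrable lborel (\<lambda>u. L ((x - u) / b))"
proof -
  have "(\<lambda>u. L ((x - u) / b)) = (\<lambda>u. L (x / b + (- (1 / b)) * u))"
    by (simp add: diff_divide_distrib)
  then show ?thesis
    using lborel_integrable_real_affine[OF assms(1), of "- (1 / b)" "x / b"] assms(2) by simp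
qed

lemma integral_kernel_affine:
  fixes L :: "real \<Rightarrow> real"
  assumes "b > 0"
  shows "(\<integral>u. L ((x - u) / b) \<partial>lborel) = b * (\<integral>v. L v \<partial>lborel)"
  using kernel_substitution[OF assms, of "\<lambda>u. L ((x - u) / b)" x] assms by simp

text \<open>The substitution \<open>u = x - b k * v\<close> moves the bandwidth into the argument of
  \<psi>, where continuity at \<open>x\<close> and the majorant \<open>B * \<bar>L v\<bar>\<close>
  allow dominated convergence. The exponent in \<open>b k ^ 1\<close> is written out to match the
  general power \<open>p\<close> of the later averages.\<close>

lemma kernel_smoothing_tendsto:
  fixes \<psi> L :: "real \<Rightarrow> real"
  assumes [measurable]: "\<psi> \<in> borel_measurable borel" and \<psi>: "\<And>u. \<bar>\<psi> u\<bar> \<le> B" "isCont \<psi> x"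
    and L: "integrable lborel L"
    and b: "\<And>k. k \<ge> 1 \<Longrightarrow> b k > 0" "b \<longlonglongrightarrow> 0"
  shows "(\<lambda>k. \<integral>u. \<psi> u * (L ((x - u) / b k) / b k ^ 1) \<partial>lborel) \<longlonglongrightarrow> \<psi> x * (\<integral>v. L v \<partial>lborel)"
proof -
  have [measurable]: "L \<in> borel_measurable borel" using borel_measurable_integrable[OF L] by simp
  have "(\<lambda>k. \<integral>v. \<psi> (x - b k * v) * L v \<partial>lborel) \<longlonglongrightarrow> (\<integral>v. \<psi> x * L v \<partial>lborel)"
  proof (rule integral_dominated_convergence[where w = "\<lambda>v. B * \<bar>L v\<bar>"])
    show "integrable lborel (\<lambda>v. B * \<bar>L v\<bar>)" using L by simp
    have "(\<lambda>k. \<psi> (x - b k * v)) \<longlonglongrightarrow> \<psi> x" for v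
      by (rule isCont_tendsto_compose[OF \<psi>(2)]) (auto intro!: tendsto_eq_intros b)
    then show "AE v in lborel. (\<lambda>k. \<psi> (x - b k * v) * L v) \<longlonglongrightarrow> \<psi> x * L v"
      by (intro AE_I2 tendsto_mult_right)
    show "AE v in lborel. norm (\<psi> (x - b k * v) * L v) \<le> B * \<bar>L v\<bar>" for k
      by (intro AE_I2) (auto simp: abs_mult intro!: mult_right_mono \<psi>)
  qed measurable
  then have "(\<lambda>k. \<integral>v. \<psi> (x - b k * v) * L v \<partial>lborel) \<longlonglongrightarrow> \<psi> x * (\<integral>v. L v \<partial>lborel)"
    by simp
  then show ?thesis
  proof (rule Lim_transform_eventually)
    show "\<forall>\<^sub>F k in sequentially. (\<integral>v. \<psi> (x - b k * v) * L v \<partial>lborel) =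
        (\<integral>u. \<psi> u * (L ((x - u) / b k) / b k ^ 1) \<partial>lborel)"
    proof (rule eventually_sequentiallyI)
      fix k :: nat assume "1 \<le> k"
      then have k: "b k > 0" by (rule b)
      have "(\<integral>u. \<psi> u * (L ((x - u) / b k) / b k ^ 1) \<partial>lborel) =
          b k * (\<integral>v. \<psi> (x - b k * v) * L v / b k \<partial>lborel)"
        using kernel_substitution[OF k, of "\<lambda>u. \<psi> u * (L ((x - u) / b k) / b k ^ 1)" x] k by simp
      then show "(\<integral>v. \<psi> (x - b k * v) * L v \<partial>lborel) =
          (\<integral>u. \<psi> u * (L ((x - u) / b k) / b k ^ 1) \<partial>lborel)"
        using k by simp
    qed
  qed
qed

text \<open>Near \<open>x\<close> by differentiability, away from \<open>x\<close> by boundedness.\<close>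

lemma bounded_derivative_imp_linear_increment:
  fixes \<psi> :: "real \<Rightarrow> real"
  assumes \<psi>: "\<And>u. \<bar>\<psi> u\<bar> \<le> B" "(\<psi> has_real_derivative d) (at x)"
  obtains C where "\<And>w. \<bar>\<psi> (x - w) - \<psi> x\<bar> \<le> C * \<bar>w\<bar>"
proof -
  have "(\<lambda>y. (\<psi> (x + y) - \<psi> x) / y) \<midarrow>0\<rightarrow> d" using \<psi>(2) by (simp add: DERIV_def)
  from LIM_D[OF this, of 1] obtain s where s: "s > 0"
    "\<And>y. y \<noteq> 0 \<Longrightarrow> \<bar>y\<bar> < s \<Longrightarrow> \<bar>(\<psi> (x + y) - \<psi> x) / y - d\<bar> < 1" by auto
  have B: "0 \<le> B" using \<psi>(1)[of 0] by linarith
  \<comment> \<open>The constant adds up the two regimes: \<open>\<bar>d\<bar> + 1\<close> bounds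
    the difference quotient for \<open>\<bar>w\<bar> < s\<close>, and beyond that the oscillation
    \<open>2 * B\<close> is at most \<open>2 * B / s * \<bar>w\<bar>\<close>.\<close>
  have "\<bar>\<psi> (x - w) - \<psi> x\<bar> \<le> (\<bar>d\<bar> + 1 + 2 * B / s) * \<bar>w\<bar>" for w
  proof (cases "\<bar>w\<bar> < s")
    case True
    show ?thesis
    proof (cases "w = 0")
      case False
      have "\<bar>(\<psi> (x - w) - \<psi> x) / (- w)\<bar> \<le> \<bar>d\<bar> + 1"
        using s(2)[of "- w"] False True by simp
      then have "\<bar>\<psi> (x - w) - \<psi> x\<bar> \<le> (\<bar>d\<bar> + 1) * \<bar>w\<bar>"
        using False by (simp add: abs_divide divide_le_eq)
      also have "\<dots> \<le> (\<bar>d\<bar> + 1 + 2 * B / s) * \<bar>w\<bar>"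
        using B s(1) by (intro mult_right_mono) auto
      finally show ?thesis .
    qed simp
  next
    case False
    have "\<bar>\<psi> (x - w) - \<psi> x\<bar> \<le> 2 * B" using \<psi>(1)[of x] \<psi>(1)[of "x - w"] by linarith
    also have "\<dots> = 2 * B / s * s" using s by simp
    also have "\<dots> \<le> 2 * B / s * \<bar>w\<bar>" using False B s(1) by (intro mult_left_mono) auto
    also have "\<dots> \<le> (\<bar>d\<bar> + 1 + 2 * B / s) * \<bar>w\<bar>" by (intro mult_right_mono) auto
    finally show ?thesis .
  qed
  then show ?thesis by (rule that)
qed

text \<open>As \<open>L\<close> integrates to 0, the constant \<open>\<psi> x\<close> may be
  subtracted from \<psi>; after substitution one factor \<open>1 / b k\<close> is left and forms a
  difference quotient. For \<open>L = deriv K\<close> the first moment \<open>m\<close> is -1, and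
  the limit is \<open>d\<close>.\<close>

lemma kernel_derivative_smoothing_tendsto:
  fixes \<psi> L :: "real \<Rightarrow> real"
  assumes [measurable]: "\<psi> \<in> borel_measurable borel"
    and \<psi>: "\<And>u. \<bar>\<psi> u\<bar> \<le> B" "(\<psi> has_real_derivative d) (at x)"
    and L: "has_bochner_integral lborel L 0" "has_bochner_integral lborel (\<lambda>v. v * L v) m"
    and b: "\<And>k. k \<ge> 1 \<Longrightarrow> b k > 0" "b \<longlonglongrightarrow> 0"
  shows "(\<lambda>k. \<integral>u. \<psi> u * (L ((x - u) / b k) / b k ^ 2) \<partial>lborel) \<longlonglongrightarrow> - d * m"
proof -
  have intL: "integrable lborel L" "integrable lborel (\<lambda>v. v * L v)"
    using L by (auto intro: integrable.intros)
  have [measurable]: "L \<in> borel_measurable borel" using borel_measurable_integrable[OF intL(1)] by simp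
  obtain C where C: "\<And>w. \<bar>\<psi> (x - w) - \<psi> x\<bar> \<le> C * \<bar>w\<bar>"
    using bounded_derivative_imp_linear_increment[OF \<psi>] by blast
  have C0: "0 \<le> C" using C[of 1] by simp
  let ?q = "\<lambda>k v. (\<psi> (x - b k * v) - \<psi> x) / b k"
  have "(\<lambda>k. \<integral>v. ?q k v * L v \<partial>lborel) \<longlonglongrightarrow> (\<integral>v. - d * (v * L v) \<partial>lborel)"
  proof (rule integral_dominated_convergence[where w = "\<lambda>v. C * \<bar>v * L v\<bar>"])
    show "integrable lborel (\<lambda>v. C * \<bar>v * L v\<bar>)" using intL by simp
    have lim: "(\<lambda>k. ?q k v) \<longlonglongrightarrow> - d * v" for v
    proof (cases "v = 0")
      case False
      have "(\<lambda>y. (\<psi> (x + y) - \<psi> x) / y) \<midarrow>0\<rightarrow> d" using \<psi>(2) by (simp add: DERIV_def)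
      moreover have "filterlim (\<lambda>k. - (b k * v)) (at 0) sequentially"
      proof (rule filterlim_atI)
        show "(\<lambda>k. - (b k * v)) \<longlonglongrightarrow> 0" by (auto intro!: tendsto_eq_intros b)
        show "\<forall>\<^sub>F k in sequentially. - (b k * v) \<noteq> 0"
          by (rule eventually_sequentiallyI[of 1]) (use b(1) False in force)
      qed
      ultimately have "(\<lambda>k. (\<psi> (x + - (b k * v)) - \<psi> x) / (- (b k * v))) \<longlonglongrightarrow> d"
        by (rule filterlim_compose)
      from tendsto_mult_right[OF this, of "- v"]
      have "(\<lambda>k. (\<psi> (x + - (b k * v)) - \<psi> x) / (- (b k * v)) * - v) \<longlonglongrightarrow> - d * v" by simp
      then show ?thesis
        using False by simp
    qed simp
    show "AE v in lborel. (\<lambda>k. ?q k v * L v) \<longlonglongrightarrow> - d * (v * L v)"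
      using tendsto_mult_right[OF lim] by (intro AE_I2) (simp add: mult.assoc)
    show "AE v in lborel. norm (?q k v * L v) \<le> C * \<bar>v * L v\<bar>" for k
    proof (rule AE_I2)
      fix v
      \<comment> \<open>Domination is required at every index, including 0, where \<open>b\<close>
        is unconstrained; if \<open>b k = 0\<close> the quotient is 0 by convention.\<close>
      have "\<bar>?q k v\<bar> \<le> C * \<bar>v\<bar>"
      proof (cases "b k = 0")
        case False
        then show ?thesis using C[of "b k * v"] by (simp add: abs_divide abs_mult divide_le_eq mult_ac)
      qed (simp add: C0)
      from mult_right_mono[OF this, of "\<bar>L v\<bar>"]
      show "norm (?q k v * L v) \<le> C * \<bar>v * L v\<bar>" by (simp add: abs_mult mult.assoc)
    qed
  qed measurable
  also have "(\<integral>v. - d * (v * L v) \<partial>lborel) = - d * m"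
    using has_bochner_integral_integral_eq[OF L(2)] by simp
  finally show ?thesis
  proof (rule Lim_transform_eventually)
    show "\<forall>\<^sub>F k in sequentially. (\<integral>v. ?q k v * L v \<partial>lborel) =
        (\<integral>u. \<psi> u * (L ((x - u) / b k) / b k ^ 2) \<partial>lborel)"
    proof (rule eventually_sequentiallyI)
      fix k :: nat assume "1 \<le> k"
      then have k: "b k > 0" by (rule b)
      have int: "integrable lborel (\<lambda>v. \<psi> (x - b k * v) * L v)"
      proof (rule Bochner_Integration.integrable_bound)
        show "integrable lborel (\<lambda>v. B * \<bar>L v\<bar>)" using intL by simp
        have "\<bar>\<psi> u * L v\<bar> \<le> \<bar>B * \<bar>L v\<bar>\<bar>" for u v
          using mult_right_mono[OF \<psi>(1)[of u], of "\<bar>L v\<bar>"] abs_ge_self[of "B * \<bar>L v\<bar>"]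
          unfolding abs_mult[of "\<psi> u"] by linarith
        then show "AE v in lborel. norm (\<psi> (x - b k * v) * L v) \<le> norm (B * \<bar>L v\<bar>)" by simp
      qed measurable
      have "(\<integral>v. ?q k v * L v \<partial>lborel) = (\<integral>v. (\<psi> (x - b k * v) * L v - \<psi> x * L v) / b k \<partial>lborel)"
        by (intro Bochner_Integration.integral_cong refl) (simp add: field_simps)
      also have "\<dots> = ((\<integral>v. \<psi> (x - b k * v) * L v \<partial>lborel) - \<psi> x * (\<integral>v. L v \<partial>lborel)) / b k"
        using int intL by simp
      also have "\<dots> = (\<integral>v. \<psi> (x - b k * v) * L v \<partial>lborel) / b k"
        using has_bochner_integral_integral_eq[OF L(1)] by simp
      also have "\<dots> = b k * (\<integral>v. \<psi> (x - b k * v) * L v / b k ^ 2 \<partial>lborel)"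
        using k by (simp add: power2_eq_square)
      also have "\<dots> = (\<integral>u. \<psi> u * (L ((x - u) / b k) / b k ^ 2) \<partial>lborel)"
        using kernel_substitution[OF k, of "\<lambda>u. \<psi> u * (L ((x - u) / b k) / b k ^ 2)" x] k by simp
      finally show "(\<integral>v. ?q k v * L v \<partial>lborel) = (\<integral>u. \<psi> u * (L ((x - u) / b k) / b k ^ 2) \<partial>lborel)" .
    qed
  qed
qed

text \<open>One factor of the squared kernel is bounded by \<open>A\<close> and the other is
  integrated. The squared weight costs at most \<open>1 / b ^ 4\<close>, and the change of variables
  gives back one \<open>b\<close>.\<close>

lemma kernel_second_moment:
  fixes g \<phi> L :: "real \<Rightarrow> real"
  assumes [measurable]: "g \<in> borel_measurable borel" "\<phi> \<in> borel_measurable borel"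
    and g: "\<And>u. 0 \<le> g u" "\<And>u. g u \<le> G" and \<phi>: "\<And>u. \<bar>\<phi> u\<bar> \<le> B"
    and L: "integrable lborel L" "\<And>v. \<bar>L v\<bar> \<le> A"
    and b: "0 < b" "b \<le> 1" and p: "p \<le> 2"
  shows "integrable lborel (\<lambda>u. g u * (\<phi> u * (L ((x - u) / b) / b ^ p))\<^sup>2)"
    and "(\<integral>u. g u * (\<phi> u * (L ((x - u) / b) / b ^ p))\<^sup>2 \<partial>lborel)
           \<le> G * B\<^sup>2 * A * (\<integral>v. \<bar>L v\<bar> \<partial>lborel) / b ^ 3"
proof -
  have [measurable]: "L \<in> borel_measurable borel" using borel_measurable_integrable[OF L(1)] by simp
  let ?c = "G * B\<^sup>2 * A / b ^ 4"
  have AL: "integrable lborel (\<lambda>v. \<bar>L v\<bar>)" using L(1) by simp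
  have bound: "g u * (\<phi> u * (L ((x - u) / b) / b ^ p))\<^sup>2 \<le> ?c * \<bar>L ((x - u) / b)\<bar>" for u
  proof -
    let ?l = "L ((x - u) / b)"
    have sq: "\<phi> u ^ 2 \<le> B\<^sup>2" using power_mono[OF \<phi>[of u], of 2] by simp
    have l: "?l\<^sup>2 \<le> A * \<bar>?l\<bar>"
      using mult_right_mono[OF L(2)[of "(x - u) / b"], of "\<bar>?l\<bar>"] by (simp add: power2_eq_square)
    \<comment> \<open>This is where \<open>b \<le> 1\<close> enters: the worst power
      \<open>p = 2\<close> covers the kernel and its derivative alike.\<close>
    have "b ^ 4 \<le> (b ^ p)\<^sup>2"
      unfolding power_mult[symmetric] using b p by (intro power_decreasing) auto
    then have lb: "?l\<^sup>2 / (b ^ p)\<^sup>2 \<le> A * \<bar>?l\<bar> / b ^ 4" using l b order_trans[OF zero_le_power2 l] by (intro frac_le) auto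
    have "g u * \<phi> u ^ 2 \<le> G * B\<^sup>2" using g sq by (intro mult_mono) (auto intro: order_trans)
    then have "g u * \<phi> u ^ 2 * (?l\<^sup>2 / (b ^ p)\<^sup>2) \<le> (G * B\<^sup>2) * (A * \<bar>?l\<bar> / b ^ 4)"
      by (rule mult_mono[OF _ lb]) (use order_trans[OF g(1) g(2)] in auto)
    then show ?thesis by (simp add: power_mult_distrib power_divide mult_ac)
  qed
  have int: "integrable lborel (\<lambda>u. ?c * \<bar>L ((x - u) / b)\<bar>)"
    using integrable_kernel_affine[OF AL b(1)] by simp
  show i: "integrable lborel (\<lambda>u. g u * (\<phi> u * (L ((x - u) / b) / b ^ p))\<^sup>2)"
  proof (rule Bochner_Integration.integrable_bound[OF int])
    show "AE u in lborel. norm (g u * (\<phi> u * (L ((x - u) / b) / b ^ p))\<^sup>2) \<le> norm (?c * \<bar>L ((x - u) / b)\<bar>)"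
      using bound g(1) by (intro AE_I2) (smt (verit) mult_nonneg_nonneg real_norm_def zero_le_power2)
  qed measurable
  have "(\<integral>u. g u * (\<phi> u * (L ((x - u) / b) / b ^ p))\<^sup>2 \<partial>lborel) \<le> (\<integral>u. ?c * \<bar>L ((x - u) / b)\<bar> \<partial>lborel)"
    by (rule integral_mono[OF i int bound])
  also have "\<dots> = ?c * (b * (\<integral>v. \<bar>L v\<bar> \<partial>lborel))"
    using integral_kernel_affine[OF b(1), of "\<lambda>v. \<bar>L v\<bar>" x] by simp
  also have "\<dots> = G * B\<^sup>2 * A * (\<integral>v. \<bar>L v\<bar> \<partial>lborel) / b ^ 3"
    using b by (simp add: power_numeral_reduce)
  finally show "(\<integral>u. g u * (\<phi> u * (L ((x - u) / b) / b ^ p))\<^sup>2 \<partial>lborel)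
           \<le> G * B\<^sup>2 * A * (\<integral>v. \<bar>L v\<bar> \<partial>lborel) / b ^ 3" .
qed

text \<open>A Markov-type bound: off the \<delta>-neighbourhood,
  \<open>((x - u) / \<delta>) ^ 4\<close> is at least 1. Inserting it trades
  \<open>1 / b\<^sup>2\<close> for \<open>b\<^sup>2 / \<delta> ^ 4\<close> times a fourth moment
  weight, and the change of variables adds another \<open>b\<close>.\<close>

lemma kernel_tail_first_moment:
  fixes w L :: "real \<Rightarrow> real"
  assumes [measurable]: "w \<in> borel_measurable borel" "L \<in> borel_measurable borel"
    and w: "\<And>u. \<bar>w u\<bar> \<le> (if \<bar>u - x\<bar> < \<delta> then 0 else \<bar>L ((x - u) / b)\<bar> / b\<^sup>2)"
    and L: "integrable lborel (\<lambda>v. v ^ 4 * \<bar>L v\<bar>)" and "0 < b" "0 < \<delta>"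
  shows "integrable lborel w"
    and "(\<integral>u. \<bar>w u\<bar> \<partial>lborel) \<le> b ^ 3 / \<delta> ^ 4 * (\<integral>v. v ^ 4 * \<bar>L v\<bar> \<partial>lborel)"
proof -
  let ?q = "\<lambda>v. v ^ 4 * \<bar>L v\<bar>"
  have bound: "\<bar>w u\<bar> \<le> b\<^sup>2 / \<delta> ^ 4 * ?q ((x - u) / b)" for u
  proof (cases "\<bar>u - x\<bar> < \<delta>")
    case True
    have "\<bar>w u\<bar> \<le> 0" using w[of u] True by simp
    also have "0 \<le> b\<^sup>2 / \<delta> ^ 4 * ?q ((x - u) / b)" by simp
    finally show ?thesis .
  next
    case False
    then have "1 \<le> (\<bar>x - u\<bar> / \<delta>) ^ 4" using \<open>0 < \<delta>\<close> by (intro one_le_power) auto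
    then have "1 \<le> ((x - u) / \<delta>) ^ 4" by (simp add: power_divide)
    then have "1 * (\<bar>L ((x - u) / b)\<bar> / b\<^sup>2) \<le> ((x - u) / \<delta>) ^ 4 * (\<bar>L ((x - u) / b)\<bar> / b\<^sup>2)"
      by (intro mult_right_mono) auto
    also have "\<dots> = b\<^sup>2 / \<delta> ^ 4 * ?q ((x - u) / b)"
      using \<open>0 < b\<close> by (simp add: power_divide eval_nat_numeral mult.assoc)
    finally show ?thesis using w[of u] False by simp
  qed
  have int: "integrable lborel (\<lambda>u. b\<^sup>2 / \<delta> ^ 4 * ?q ((x - u) / b))"
    by (intro integrable_mult_right integrable_kernel_affine[OF L] \<open>0 < b\<close>)
  show i: "integrable lborel w"
    by (rule Bochner_Integration.integrable_bound[OF int]) (auto intro!: order_trans[OF bound])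
  have "(\<integral>u. \<bar>w u\<bar> \<partial>lborel) \<le> (\<integral>u. b\<^sup>2 / \<delta> ^ 4 * ?q ((x - u) / b) \<partial>lborel)"
    by (rule integral_mono[OF integrable_abs[OF i] int bound])
  also have "\<dots> = b\<^sup>2 / \<delta> ^ 4 * (b * (\<integral>v. ?q v \<partial>lborel))"
    using integral_kernel_affine[OF \<open>0 < b\<close>, of ?q x] by (simp only: integral_mult_right_zero)
  finally show "(\<integral>u. \<bar>w u\<bar> \<partial>lborel) \<le> b ^ 3 / \<delta> ^ 4 * (\<integral>v. ?q v \<partial>lborel)"
    by (simp add: power_numeral_reduce)
qed

section \<open>Kernel averages over a random design\<close>

lemma (in prob_space) indep_vars_imp_indep_var:
  assumes "indep_vars N X I" "i \<in> I" "j \<in> I" "i \<noteq> j"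
  shows "indep_var (N i) (X i) (N j) (X j)"
proof -
  have "indep_var (PiM {i} N) (\<lambda>\<omega>. restrict (\<lambda>i. X i \<omega>) {i}) (PiM {j} N) (\<lambda>\<omega>. restrict (\<lambda>i. X i \<omega>) {j})"
    using assms by (intro indep_var_restrict[OF assms(1)]) auto
  from indep_var_compose[OF this measurable_component_singleton[of i] measurable_component_singleton[of j]]
  show ?thesis by (simp add: comp_def)
qed

locale random_design = prob_space M
  for M :: "'a measure" +
  fixes X \<epsilon> :: "nat \<Rightarrow> 'a \<Rightarrow> real" and g :: "real \<Rightarrow> real" and h :: "nat \<Rightarrow> real"
    and G \<sigma> \<alpha> :: real
  assumes X_indep: "indep_vars (\<lambda>_. borel) X {1..}"
    and g_nonneg: "\<And>u. g u \<ge> 0"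
    and g_bounded: "\<And>u. g u \<le> G"
    and X_density: "\<And>n. n \<ge> 1 \<Longrightarrow> distributed M lborel (X n) (\<lambda>u. ennreal (g u))"
    and eps_X_indep: "indep_var
          (Pi\<^sub>M {1..} (\<lambda>_. borel)) (\<lambda>\<omega>. \<lambda>n\<in>{1..}. \<epsilon> n \<omega>)
          (Pi\<^sub>M {1..} (\<lambda>_. borel)) (\<lambda>\<omega>. \<lambda>n\<in>{1..}. X n \<omega>)"
    and eps_indep: "indep_vars (\<lambda>_. borel) \<epsilon> {1..}"
    and eps_sq_int: "\<And>n. n \<ge> 1 \<Longrightarrow> integrable M (\<lambda>\<omega>. (\<epsilon> n \<omega>)\<^sup>2)"
    and eps_mean: "\<And>n. n \<ge> 1 \<Longrightarrow> expectation (\<epsilon> n) = 0"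
    and eps_var: "\<And>n. n \<ge> 1 \<Longrightarrow> expectation (\<lambda>\<omega>. (\<epsilon> n \<omega>)\<^sup>2) = \<sigma>\<^sup>2"
    and bandwidth: "\<And>n. n \<ge> 1 \<Longrightarrow> h n = real n powr (- \<alpha>)"
    and alpha: "0 < \<alpha>" "\<alpha> < 1 / 3"
begin

section \<open>Measurability, bandwidth powers, and transfer of expectations to the density\<close>

lemma X_measurable [measurable]: "k \<ge> 1 \<Longrightarrow> X k \<in> borel_measurable M"
  using distributed_measurable[OF X_density[of k]] by simp

lemma eps_measurable [measurable]: "k \<ge> 1 \<Longrightarrow> \<epsilon> k \<in> borel_measurable M"
  using eps_indep by (auto simp: indep_vars_def)

lemma g_measurable [measurable]: "g \<in> borel_measurable borel"
  using distributed_real_measurable[OF _ X_density[of 1]] g_nonneg by simp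

lemma h_pos: "k \<ge> 1 \<Longrightarrow> 0 < h k"
  and h_le_1: "k \<ge> 1 \<Longrightarrow> h k \<le> 1"
  and h_power: "k \<ge> 1 \<Longrightarrow> h k ^ 3 = real k powr (- (3 * \<alpha>))"
proof -
  assume k: "k \<ge> 1"
  then have hk: "h k = real k powr (- \<alpha>)" by (rule bandwidth)
  show "0 < h k" using k by (simp add: hk)
  show "h k \<le> 1" using k alpha by (simp add: hk powr_minus inverse_le_1_iff ge_one_powr_ge_zero)
  have "h k ^ 3 = real k powr (- \<alpha> + - \<alpha> + - \<alpha>)"
    by (simp only: hk powr_add power3_eq_cube)
  also have "- \<alpha> + - \<alpha> + - \<alpha> = - (3 * \<alpha>)" by simp
  finally show "h k ^ 3 = real k powr (- (3 * \<alpha>))" .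
qed

lemma h_tendsto_0: "h \<longlonglongrightarrow> 0"
proof (rule Lim_transform_eventually)
  show "(\<lambda>n. real n powr (- \<alpha>)) \<longlonglongrightarrow> 0"
    using alpha by (intro tendsto_neg_powr filterlim_real_sequentially) auto
  show "\<forall>\<^sub>F n in sequentially. real n powr (- \<alpha>) = h n"
    by (rule eventually_sequentiallyI[of 1]) (simp add: bandwidth)
qed

lemma design_integrable_iff:
  fixes a :: "real \<Rightarrow> real"
  assumes "k \<ge> 1" "a \<in> borel_measurable borel"
  shows "integrable M (\<lambda>\<omega>. a (X k \<omega>)) \<longleftrightarrow> integrable lborel (\<lambda>u. g u * a u)"
  using distributed_integrable[OF X_density, of k a] assms g_nonneg by simp

lemma design_expectation:
  fixes a :: "real \<Rightarrow> real"
  assumes "k \<ge> 1" "a \<in> borel_measurable borel"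
  shows "expectation (\<lambda>\<omega>. a (X k \<omega>)) = (\<integral>u. g u * a u \<partial>lborel)"
  using distributed_integral[OF X_density, of k a] assms g_nonneg by simp

text \<open>Orthogonality of the noise terms needs a pair of errors to be independent of a pair of
  design points, which comes from independence of the whole sequences by composing with coordinate
  maps. Equal indices are allowed and give the single-index case.\<close>

lemma eps_design_indep:
  assumes "i \<ge> 1" "j \<ge> 1"
    and F [measurable]: "case_prod F \<in> borel_measurable (borel \<Otimes>\<^sub>M borel)"
    and H [measurable]: "case_prod H \<in> borel_measurable (borel \<Otimes>\<^sub>M borel)"
  shows "indep_var borel (\<lambda>\<omega>. F (\<epsilon> i \<omega>) (\<epsilon> j \<omega>) :: real) borel (\<lambda>\<omega>. H (X i \<omega>) (X j \<omega>) :: real)"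
proof -
  have [measurable]: "(\<lambda>e. e k) \<in> borel_measurable (Pi\<^sub>M {1..} (\<lambda>_. borel))" if "k \<ge> 1" for k :: nat
    using that by (intro measurable_component_singleton) simp
  have "indep_var borel ((\<lambda>e. F (e i) (e j)) \<circ> (\<lambda>\<omega>. \<lambda>n\<in>{1..}. \<epsilon> n \<omega>))
      borel ((\<lambda>e. H (e i) (e j)) \<circ> (\<lambda>\<omega>. \<lambda>n\<in>{1..}. X n \<omega>))"
    using assms(1,2) by (intro indep_var_compose[OF eps_X_indep]) measurable
  then show ?thesis using assms(1,2) by (simp add: comp_def)
qed

lemma eps_design_indep_single:
  fixes a e :: "real \<Rightarrow> real"
  assumes "k \<ge> 1" and [measurable]: "e \<in> borel_measurable borel" "a \<in> borel_measurable borel"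
  shows "indep_var borel (\<lambda>\<omega>. e (\<epsilon> k \<omega>)) borel (\<lambda>\<omega>. a (X k \<omega>))"
  by (rule eps_design_indep[of k k "\<lambda>u _. e u" "\<lambda>u _. a u"]) (use assms(1) in measurable)

lemma eps_integrable: "k \<ge> 1 \<Longrightarrow> integrable M (\<epsilon> k)"
  by (rule square_integrable_imp_integrable[OF _ eps_sq_int]) simp_all

text \<open>Centring the summands makes them orthogonal by pairwise independence, with variances
  below the second moments, hence of order \<open>k powr (3 * \<alpha>)\<close> with exponent below
  1. The subtracted means are restored by Cesaro averaging.\<close>

lemma design_mean_tendsto_AE:
  fixes a :: "nat \<Rightarrow> real \<Rightarrow> real"
  assumes [measurable]: "\<And>k. a k \<in> borel_measurable borel"
    and sq: "\<And>k. k \<ge> 1 \<Longrightarrow> integrable lborel (\<lambda>u. g u * (a k u)\<^sup>2)"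
    and le: "\<And>k. k \<ge> 1 \<Longrightarrow> (\<integral>u. g u * (a k u)\<^sup>2 \<partial>lborel) \<le> C * real k powr (3 * \<alpha>)"
    and lim: "(\<lambda>k. \<integral>u. g u * a k u \<partial>lborel) \<longlonglongrightarrow> l"
  shows "AE \<omega> in M. (\<lambda>n. (1 / real n) * (\<Sum>k=1..n. a k (X k \<omega>))) \<longlonglongrightarrow> l"
proof -
  define \<mu> where "\<mu> k = (\<integral>u. g u * a k u \<partial>lborel)" for k
  define W where "W k \<omega> = a k (X k \<omega>) - \<mu> k" for k \<omega>
  have sqM: "integrable M (\<lambda>\<omega>. (a k (X k \<omega>))\<^sup>2)" if "k \<ge> 1" for k
    using that sq[OF that] by (subst design_integrable_iff[of k "\<lambda>u. (a k u)\<^sup>2"]) auto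
  have aM: "integrable M (\<lambda>\<omega>. a k (X k \<omega>))" if "k \<ge> 1" for k
    using that by (intro square_integrable_imp_integrable[OF _ sqM[OF that]]) measurable
  have mean: "expectation (\<lambda>\<omega>. a k (X k \<omega>)) = \<mu> k" if "k \<ge> 1" for k
    unfolding \<mu>_def using that by (intro design_expectation) auto
  have W_int: "integrable M (W k)" "expectation (W k) = 0" if "k \<ge> 1" for k
    using aM[OF that] mean[OF that] unfolding W_def[abs_def] by (auto simp: prob_space)
  have Wsq: "(W k \<omega>)\<^sup>2 = (a k (X k \<omega>))\<^sup>2 - 2 * \<mu> k * a k (X k \<omega>) + (\<mu> k)\<^sup>2" for k \<omega>
    by (simp add: W_def power2_eq_square algebra_simps)
  have W_sq: "integrable M (\<lambda>\<omega>. (W k \<omega>)\<^sup>2)" if "k \<ge> 1" for k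
    unfolding Wsq using sqM[OF that] aM[OF that] by auto
  interpret orthogonal_sequence M W
  proof
    fix k :: nat assume k: "k \<ge> 1"
    show "W k \<in> borel_measurable M" using k unfolding W_def[abs_def] by measurable
    show "integrable M (\<lambda>\<omega>. (W k \<omega>)\<^sup>2)" by (rule W_sq[OF k])
  next
    fix i j :: nat assume ij: "i \<ge> 1" "j \<ge> 1" "i \<noteq> j"
    have "indep_var borel (X i) borel (X j)"
      using ij by (intro indep_vars_imp_indep_var[OF X_indep]) auto
    from indep_var_compose[OF this, of "\<lambda>u. a i u - \<mu> i" borel "\<lambda>u. a j u - \<mu> j" borel]
    have "indep_var borel (W i) borel (W j)" by (simp add: comp_def W_def[abs_def])
    then have "expectation (\<lambda>\<omega>. W i \<omega> * W j \<omega>) = expectation (W i) * expectation (W j)"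
      using ij by (intro indep_var_lebesgue_integral W_int)
    then show "expectation (\<lambda>\<omega>. W i \<omega> * W j \<omega>) = 0" using ij by (simp add: W_int)
  qed
  have "AE \<omega> in M. (\<lambda>n. (1 / real n) * (\<Sum>k=1..n. W k \<omega>)) \<longlonglongrightarrow> 0"
  proof (rule mean_tendsto_0_AE)
    fix k :: nat assume k: "k \<ge> 1"
    have "expectation (\<lambda>\<omega>. (W k \<omega>)\<^sup>2) = expectation (\<lambda>\<omega>. (a k (X k \<omega>))\<^sup>2) - (\<mu> k)\<^sup>2"
      unfolding Wsq using sqM[OF k] aM[OF k] mean[OF k] by (simp add: prob_space power2_eq_square)
    also have "\<dots> \<le> expectation (\<lambda>\<omega>. (a k (X k \<omega>))\<^sup>2)" by simp
    also have "\<dots> = (\<integral>u. g u * (a k u)\<^sup>2 \<partial>lborel)"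
      using k by (intro design_expectation) auto
    also have "\<dots> \<le> C * real k powr (3 * \<alpha>)" by (rule le[OF k])
    finally show "expectation (\<lambda>\<omega>. (W k \<omega>)\<^sup>2) \<le> C * real k powr (3 * \<alpha>)" .
  qed (use alpha in auto)
  then show ?thesis
  proof eventually_elim
    fix \<omega> assume "(\<lambda>n. (1 / real n) * (\<Sum>k=1..n. W k \<omega>)) \<longlonglongrightarrow> 0"
    from tendsto_add[OF this cesaro_mean_tendsto[OF lim]]
    show "(\<lambda>n. (1 / real n) * (\<Sum>k=1..n. a k (X k \<omega>))) \<longlonglongrightarrow> l"
      by (simp add: W_def \<mu>_def sum_subtractf algebra_simps)
  qed
qed

text \<open>Here the errors supply the centring: a mixed product splits into an error part of mean 0
  and a design part, and a square contributes the factor \<open>\<sigma>\<^sup>2\<close>.\<close>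

lemma noise_mean_tendsto_0_AE:
  fixes a :: "nat \<Rightarrow> real \<Rightarrow> real"
  assumes [measurable]: "\<And>k. a k \<in> borel_measurable borel"
    and sq: "\<And>k. k \<ge> 1 \<Longrightarrow> integrable lborel (\<lambda>u. g u * (a k u)\<^sup>2)"
    and le: "\<And>k. k \<ge> 1 \<Longrightarrow> (\<integral>u. g u * (a k u)\<^sup>2 \<partial>lborel) \<le> C * real k powr (3 * \<alpha>)"
  shows "AE \<omega> in M. (\<lambda>n. (1 / real n) * (\<Sum>k=1..n. \<epsilon> k \<omega> * a k (X k \<omega>))) \<longlonglongrightarrow> 0"
proof -
  have sqM: "integrable M (\<lambda>\<omega>. (a k (X k \<omega>))\<^sup>2)" if "k \<ge> 1" for k
    using that sq[OF that] by (subst design_integrable_iff[of k "\<lambda>u. (a k u)\<^sup>2"]) auto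
  have indep: "indep_var borel (\<lambda>\<omega>. (\<epsilon> k \<omega>)\<^sup>2) borel (\<lambda>\<omega>. (a k (X k \<omega>))\<^sup>2)" if "k \<ge> 1" for k
    using that by (intro eps_design_indep_single[of k "\<lambda>u. u\<^sup>2" "\<lambda>u. (a k u)\<^sup>2"]) auto
  interpret orthogonal_sequence M "\<lambda>k \<omega>. \<epsilon> k \<omega> * a k (X k \<omega>)"
  proof
    fix k :: nat assume k: "k \<ge> 1"
    show "(\<lambda>\<omega>. \<epsilon> k \<omega> * a k (X k \<omega>)) \<in> borel_measurable M" using k by measurable
    show "integrable M (\<lambda>\<omega>. (\<epsilon> k \<omega> * a k (X k \<omega>))\<^sup>2)"
      unfolding power_mult_distrib by (rule indep_var_integrable[OF indep eps_sq_int sqM]) fact+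
  next
    fix i j :: nat assume ij: "i \<ge> 1" "j \<ge> 1" "i \<noteq> j"
    have ee: "indep_var borel (\<epsilon> i) borel (\<epsilon> j)"
      using ij by (intro indep_vars_imp_indep_var[OF eps_indep]) auto
    have e0: "expectation (\<lambda>\<omega>. \<epsilon> i \<omega> * \<epsilon> j \<omega>) = 0"
      using indep_var_lebesgue_integral[OF ee] ij by (simp add: eps_integrable eps_mean)
    have ei: "integrable M (\<lambda>\<omega>. \<epsilon> i \<omega> * \<epsilon> j \<omega>)"
      using ij by (intro indep_var_integrable[OF ee] eps_integrable)
    have XX: "indep_var borel (X i) borel (X j)"
      using ij by (intro indep_vars_imp_indep_var[OF X_indep]) auto
    have ai: "integrable M (\<lambda>\<omega>. a i (X i \<omega>) * a j (X j \<omega>))"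
    proof (rule indep_var_integrable)
      show "indep_var borel (\<lambda>\<omega>. a i (X i \<omega>)) borel (\<lambda>\<omega>. a j (X j \<omega>))"
        using indep_var_compose[OF XX, of "a i" borel "a j" borel] by (simp add: comp_def)
      show "integrable M (\<lambda>\<omega>. a i (X i \<omega>))"
        using ij by (intro square_integrable_imp_integrable[OF _ sqM]) measurable
      show "integrable M (\<lambda>\<omega>. a j (X j \<omega>))"
        using ij by (intro square_integrable_imp_integrable[OF _ sqM]) measurable
    qed
    \<comment> \<open>The four factors are regrouped, both errors against both design weights, so
      that the vanishing expectation of the error product can be factored out.\<close>
    have "indep_var borel (\<lambda>\<omega>. \<epsilon> i \<omega> * \<epsilon> j \<omega>) borel (\<lambda>\<omega>. a i (X i \<omega>) * a j (X j \<omega>))"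
      using ij(1,2) by (intro eps_design_indep[of i j "\<lambda>u v. u * v" "\<lambda>u v. a i u * a j v"]) measurable
    from indep_var_lebesgue_integral[OF this ei ai]
    have "expectation (\<lambda>\<omega>. (\<epsilon> i \<omega> * \<epsilon> j \<omega>) * (a i (X i \<omega>) * a j (X j \<omega>))) = 0" by (simp add: e0)
    then show "expectation (\<lambda>\<omega>. (\<epsilon> i \<omega> * a i (X i \<omega>)) * (\<epsilon> j \<omega> * a j (X j \<omega>))) = 0"
      by (simp add: mult_ac)
  qed
  show ?thesis
  proof (rule mean_tendsto_0_AE)
    fix k :: nat assume k: "k \<ge> 1"
    have "expectation (\<lambda>\<omega>. (\<epsilon> k \<omega> * a k (X k \<omega>))\<^sup>2) =
        expectation (\<lambda>\<omega>. (\<epsilon> k \<omega>)\<^sup>2) * expectation (\<lambda>\<omega>. (a k (X k \<omega>))\<^sup>2)"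
      unfolding power_mult_distrib by (rule indep_var_lebesgue_integral[OF indep eps_sq_int sqM]) fact+
    also have "\<dots> = \<sigma>\<^sup>2 * (\<integral>u. g u * (a k u)\<^sup>2 \<partial>lborel)"
      using design_expectation[OF k, of "\<lambda>u. (a k u)\<^sup>2"] by (simp add: eps_var[OF k])
    also have "\<dots> \<le> \<sigma>\<^sup>2 * (C * real k powr (3 * \<alpha>))" by (intro mult_left_mono le[OF k]) simp
    finally show "expectation (\<lambda>\<omega>. (\<epsilon> k \<omega> * a k (X k \<omega>))\<^sup>2) \<le> \<sigma>\<^sup>2 * C * real k powr (3 * \<alpha>)"
      by (simp add: mult.assoc)
  qed (use alpha in auto)
qed

lemma kernel_weights_square_integrable:
  fixes \<phi> L :: "real \<Rightarrow> real"
  assumes [measurable]: "\<phi> \<in> borel_measurable borel" and \<phi>: "\<And>u. \<bar>\<phi> u\<bar> \<le> B"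
    and L: "integrable lborel L" "\<And>v. \<bar>L v\<bar> \<le> A" and p: "p \<le> 2" and k: "k \<ge> 1"
  shows "integrable lborel (\<lambda>u. g u * (\<phi> u * (L ((x - u) / h k) / h k ^ p))\<^sup>2)"
    and "(\<integral>u. g u * (\<phi> u * (L ((x - u) / h k) / h k ^ p))\<^sup>2 \<partial>lborel)
           \<le> G * B\<^sup>2 * A * (\<integral>v. \<bar>L v\<bar> \<partial>lborel) * real k powr (3 * \<alpha>)"
proof -
  have "1 / h k ^ 3 = real k powr (3 * \<alpha>)"
    using k by (simp add: h_power powr_minus field_simps)
  then have eq: "G * B\<^sup>2 * A * (\<integral>v. \<bar>L v\<bar> \<partial>lborel) / h k ^ 3 =
      G * B\<^sup>2 * A * (\<integral>v. \<bar>L v\<bar> \<partial>lborel) * real k powr (3 * \<alpha>)"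
    by (metis times_divide_eq_right mult.right_neutral)
  note * = kernel_second_moment[OF g_measurable assms(1) g_nonneg g_bounded \<phi> L h_pos[OF k] h_le_1[OF k] p]
  show "integrable lborel (\<lambda>u. g u * (\<phi> u * (L ((x - u) / h k) / h k ^ p))\<^sup>2)" by (rule *(1))
  show "(\<integral>u. g u * (\<phi> u * (L ((x - u) / h k) / h k ^ p))\<^sup>2 \<partial>lborel)
      \<le> G * B\<^sup>2 * A * (\<integral>v. \<bar>L v\<bar> \<partial>lborel) * real k powr (3 * \<alpha>)"
    using *(2)[of x] unfolding eq .
qed

lemma design_kernel_mean_AE:
  fixes \<phi> L :: "real \<Rightarrow> real"
  assumes [measurable]: "\<phi> \<in> borel_measurable borel" and \<phi>: "\<And>u. \<bar>\<phi> u\<bar> \<le> B"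
    and L: "integrable lborel L" "\<And>v. \<bar>L v\<bar> \<le> A" and p: "p \<le> 2"
    and lim: "(\<lambda>k. \<integral>u. (g u * \<phi> u) * (L ((x - u) / h k) / h k ^ p) \<partial>lborel) \<longlonglongrightarrow> l"
  shows "AE \<omega> in M. (\<lambda>n. (1 / real n) *
           (\<Sum>k=1..n. \<phi> (X k \<omega>) * (L ((x - X k \<omega>) / h k) / h k ^ p))) \<longlonglongrightarrow> l"
proof -
  have [measurable]: "L \<in> borel_measurable borel" using borel_measurable_integrable[OF L(1)] by simp
  show ?thesis
    by (rule design_mean_tendsto_AE[OF _ kernel_weights_square_integrable[OF assms(1) \<phi> L p]])
       (use lim in \<open>auto simp: mult.assoc\<close>)
qed

lemma noise_kernel_mean_AE:
  fixes \<phi> L :: "real \<Rightarrow> real"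
  assumes [measurable]: "\<phi> \<in> borel_measurable borel" and \<phi>: "\<And>u. \<bar>\<phi> u\<bar> \<le> B"
    and L: "integrable lborel L" "\<And>v. \<bar>L v\<bar> \<le> A" and p: "p \<le> 2"
  shows "AE \<omega> in M. (\<lambda>n. (1 / real n) *
           (\<Sum>k=1..n. \<epsilon> k \<omega> * (\<phi> (X k \<omega>) * (L ((x - X k \<omega>) / h k) / h k ^ p)))) \<longlonglongrightarrow> 0"
proof -
  have [measurable]: "L \<in> borel_measurable borel" using borel_measurable_integrable[OF L(1)] by simp
  show ?thesis
    by (rule noise_mean_tendsto_0_AE[OF _ kernel_weights_square_integrable[OF assms(1) \<phi> L p]]) measurable
qed

text \<open>The bound is placed on \<open>g u * w k u\<close> because the density in the expectation
  cancels a weight \<open>1 / g\<close>, which may be unbounded. The first moments are then of order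
  \<open>h k ^ 3 = k powr (- (3 * \<alpha>))\<close>; the bounded \<open>f\<close> and the
  independent error change only the constant.\<close>

lemma far_mean_tendsto_0_AE:
  fixes f L :: "real \<Rightarrow> real" and w :: "nat \<Rightarrow> real \<Rightarrow> real"
  assumes f [measurable]: "f \<in> borel_measurable borel" and B: "\<And>u. \<bar>f u\<bar> \<le> B"
    and w [measurable]: "\<And>k. w k \<in> borel_measurable borel" and [measurable]: "L \<in> borel_measurable borel"
    and L: "integrable lborel (\<lambda>v. v ^ 4 * \<bar>L v\<bar>)" and \<delta>: "0 < \<delta>"
    and le: "\<And>k u. k \<ge> 1 \<Longrightarrow> \<bar>g u * w k u\<bar> \<le> (if \<bar>u - x\<bar> < \<delta> then 0 else \<bar>L ((x - u) / h k)\<bar> / (h k)\<^sup>2)"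
  shows "AE \<omega> in M. (\<lambda>n. (1 / real n) * (\<Sum>k=1..n. (f (X k \<omega>) + \<epsilon> k \<omega>) * w k (X k \<omega>))) \<longlonglongrightarrow> 0"
proof -
  define C where "C = (\<integral>v. v ^ 4 * \<bar>L v\<bar> \<partial>lborel) / \<delta> ^ 4"
  have C0: "0 \<le> C" using \<delta> by (auto simp: C_def)
  have wM: "integrable M (\<lambda>\<omega>. w k (X k \<omega>))"
    and wE: "expectation (\<lambda>\<omega>. \<bar>w k (X k \<omega>)\<bar>) \<le> C * real k powr (- (3 * \<alpha>))" if k: "k \<ge> 1" for k
  proof -
    note * = kernel_tail_first_moment[of "\<lambda>u. g u * w k u" L, OF _ _ le[OF k] L h_pos[OF k] \<delta>]
    show "integrable M (\<lambda>\<omega>. w k (X k \<omega>))" using *(1) k by (simp add: design_integrable_iff)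
    have "expectation (\<lambda>\<omega>. \<bar>w k (X k \<omega>)\<bar>) = (\<integral>u. g u * \<bar>w k u\<bar> \<partial>lborel)"
      using k by (intro design_expectation) auto
    also have "\<dots> = (\<integral>u. \<bar>g u * w k u\<bar> \<partial>lborel)" using g_nonneg by (simp add: abs_mult)
    also have "\<dots> \<le> h k ^ 3 / \<delta> ^ 4 * (\<integral>v. v ^ 4 * \<bar>L v\<bar> \<partial>lborel)" by (rule *(2)) measurable
    finally show "expectation (\<lambda>\<omega>. \<bar>w k (X k \<omega>)\<bar>) \<le> C * real k powr (- (3 * \<alpha>))"
      using k by (simp add: C_def h_power mult_ac)
  qed
  have fw: "\<bar>f (X k \<omega>) * w k (X k \<omega>)\<bar> \<le> B * \<bar>w k (X k \<omega>)\<bar>" for k \<omega>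
    using B by (simp add: abs_mult mult_right_mono)
  have f_AE: "AE \<omega> in M. (\<lambda>n. (1 / real n) * (\<Sum>k=1..n. f (X k \<omega>) * w k (X k \<omega>))) \<longlonglongrightarrow> 0"
  proof (rule mean_tendsto_0_AE_of_first_moments)
    fix k :: nat assume k: "k \<ge> 1"
    have int: "integrable M (\<lambda>\<omega>. B * \<bar>w k (X k \<omega>)\<bar>)" using wM[OF k] by simp
    show i: "integrable M (\<lambda>\<omega>. f (X k \<omega>) * w k (X k \<omega>))"
      by (rule Bochner_Integration.integrable_bound[OF int])
         (use k in \<open>auto intro!: order_trans[OF fw]\<close>)
    have "expectation (\<lambda>\<omega>. \<bar>f (X k \<omega>) * w k (X k \<omega>)\<bar>) \<le> expectation (\<lambda>\<omega>. B * \<bar>w k (X k \<omega>)\<bar>)"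
      by (rule integral_mono[OF integrable_abs[OF i] int fw])
    also have "\<dots> = B * expectation (\<lambda>\<omega>. \<bar>w k (X k \<omega>)\<bar>)" by simp
    also have "\<dots> \<le> B * (C * real k powr (- (3 * \<alpha>)))"
      using wE[OF k] B[of 0] by (intro mult_left_mono) auto
    finally show "expectation (\<lambda>\<omega>. \<bar>f (X k \<omega>) * w k (X k \<omega>)\<bar>) \<le> B * C * real k powr (- (3 * \<alpha>))"
      by (simp add: mult.assoc)
  qed (use alpha in simp)
  have e_AE: "AE \<omega> in M. (\<lambda>n. (1 / real n) * (\<Sum>k=1..n. \<epsilon> k \<omega> * w k (X k \<omega>))) \<longlonglongrightarrow> 0"
  proof (rule mean_tendsto_0_AE_of_first_moments)
    fix k :: nat assume k: "k \<ge> 1"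
    show "integrable M (\<lambda>\<omega>. \<epsilon> k \<omega> * w k (X k \<omega>))"
      using indep_var_integrable[OF eps_design_indep_single[OF k, of "\<lambda>u. u" "w k"] eps_integrable[OF k] wM[OF k]]
      by simp
    \<comment> \<open>Gives the bound \<open>1 + \<sigma>\<^sup>2\<close> on the first absolute
      moment of the errors, uniform in \<open>k\<close>.\<close>
    have "\<bar>e\<bar> \<le> 1 + e\<^sup>2" for e :: real
      using zero_le_power2[of "\<bar>e\<bar> - 1"] by (simp add: power2_diff)
    then have "expectation (\<lambda>\<omega>. \<bar>\<epsilon> k \<omega>\<bar>) \<le> expectation (\<lambda>\<omega>. 1 + (\<epsilon> k \<omega>)\<^sup>2)"
      using eps_integrable[OF k] eps_sq_int[OF k] by (intro integral_mono) auto
    also have "\<dots> = 1 + \<sigma>\<^sup>2" using eps_sq_int[OF k] eps_var[OF k] by (simp add: prob_space)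
    finally have E: "expectation (\<lambda>\<omega>. \<bar>\<epsilon> k \<omega>\<bar>) \<le> 1 + \<sigma>\<^sup>2" .
    have "expectation (\<lambda>\<omega>. \<bar>\<epsilon> k \<omega> * w k (X k \<omega>)\<bar>) =
        expectation (\<lambda>\<omega>. \<bar>\<epsilon> k \<omega>\<bar>) * expectation (\<lambda>\<omega>. \<bar>w k (X k \<omega>)\<bar>)"
      unfolding abs_mult using eps_integrable[OF k] wM[OF k]
      by (intro indep_var_lebesgue_integral eps_design_indep_single[OF k]) auto
    also have "\<dots> \<le> (1 + \<sigma>\<^sup>2) * (C * real k powr (- (3 * \<alpha>)))"
      by (intro mult_mono E wE[OF k]) auto
    finally show "expectation (\<lambda>\<omega>. \<bar>\<epsilon> k \<omega> * w k (X k \<omega>)\<bar>) \<le> (1 + \<sigma>\<^sup>2) * C * real k powr (- (3 * \<alpha>))"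
      by (simp add: mult.assoc)
  qed (use alpha in simp)
  from f_AE e_AE show ?thesis
  proof eventually_elim
    fix \<omega>
    assume "(\<lambda>n. (1 / real n) * (\<Sum>k=1..n. f (X k \<omega>) * w k (X k \<omega>))) \<longlonglongrightarrow> 0"
      and "(\<lambda>n. (1 / real n) * (\<Sum>k=1..n. \<epsilon> k \<omega> * w k (X k \<omega>))) \<longlonglongrightarrow> 0"
    from tendsto_add[OF this]
    show "(\<lambda>n. (1 / real n) * (\<Sum>k=1..n. (f (X k \<omega>) + \<epsilon> k \<omega>) * w k (X k \<omega>))) \<longlonglongrightarrow> 0"
      by (simp add: distrib_left distrib_right sum.distrib)
  qed
qed

text \<open>The response splits into a design average with weight \<open>f u * \<phi> u\<close>,
  which carries the limit, and a noise average, which vanishes.\<close>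

lemma response_kernel_mean_AE:
  fixes f \<phi> L :: "real \<Rightarrow> real"
  assumes f: "f \<in> borel_measurable borel" "\<And>u. \<bar>f u\<bar> \<le> B"
    and \<phi>: "\<phi> \<in> borel_measurable borel" "\<And>u. \<bar>\<phi> u\<bar> \<le> B'"
    and L: "integrable lborel L" "\<And>v. \<bar>L v\<bar> \<le> A" and p: "p \<le> 2"
    and lim: "(\<lambda>k. \<integral>u. (g u * (f u * \<phi> u)) * (L ((x - u) / h k) / h k ^ p) \<partial>lborel) \<longlonglongrightarrow> l"
  shows "AE \<omega> in M. (\<lambda>n. (1 / real n) *
           (\<Sum>k=1..n. (f (X k \<omega>) + \<epsilon> k \<omega>) * (\<phi> (X k \<omega>) * (L ((x - X k \<omega>) / h k) / h k ^ p)))) \<longlonglongrightarrow> l"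
proof -
  have "\<bar>f u * \<phi> u\<bar> \<le> B * B'" for u
    unfolding abs_mult using f(2) order_trans[OF abs_ge_zero f(2)] \<phi>(2) by (intro mult_mono) auto
  note design = design_kernel_mean_AE[OF borel_measurable_times[OF f(1) \<phi>(1)] this L p lim]
  from design noise_kernel_mean_AE[OF \<phi> L p, of x] show ?thesis
  proof eventually_elim
    fix \<omega>
    assume "(\<lambda>n. (1 / real n) * (\<Sum>k=1..n. f (X k \<omega>) * \<phi> (X k \<omega>) * (L ((x - X k \<omega>) / h k) / h k ^ p))) \<longlonglongrightarrow> l"
      and "(\<lambda>n. (1 / real n) * (\<Sum>k=1..n. \<epsilon> k \<omega> * (\<phi> (X k \<omega>) * (L ((x - X k \<omega>) / h k) / h k ^ p)))) \<longlonglongrightarrow> 0"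
    from tendsto_add[OF this]
    show "(\<lambda>n. (1 / real n) *
           (\<Sum>k=1..n. (f (X k \<omega>) + \<epsilon> k \<omega>) * (\<phi> (X k \<omega>) * (L ((x - X k \<omega>) / h k) / h k ^ p)))) \<longlonglongrightarrow> l"
      by (simp only: add_0_right sum.distrib[symmetric] distrib_left[symmetric] distrib_right mult.assoc)
  qed
qed

end

section \<open>The three derivative estimators\<close>

theorem theorem3p1:
  fixes M :: "'a measure"
    and X Y \<epsilon> :: "nat \<Rightarrow> 'a \<Rightarrow> real"
    and f g K :: "real \<Rightarrow> real"
    and h :: "nat \<Rightarrow> real"
    and \<sigma> \<alpha> x :: real
  assumes prob: "prob_space M"
    and model: "\<And>n \<omega>. n \<ge> 1 \<Longrightarrow> \<omega> \<in> space M \<Longrightarrow> Y n \<omega> = f (X n \<omega>) + \<epsilon> n \<omega>"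
    and X_indep: "prob_space.indep_vars M (\<lambda>_. borel) X {1..}"
    and g_nonneg: "\<And>u. g u \<ge> 0"
    and X_density: "\<And>n. n \<ge> 1 \<Longrightarrow> distributed M lborel (X n) (\<lambda>u. ennreal (g u))"
    and kernel: "admissible_kernel K"
    and f_smooth: "bounded_twice_differentiable f"
    and g_smooth: "bounded_twice_differentiable g"
    and eps_X_indep: "prob_space.indep_var M
          (Pi\<^sub>M {1..} (\<lambda>_. borel)) (\<lambda>\<omega>. \<lambda>n\<in>{1..}. \<epsilon> n \<omega>)
          (Pi\<^sub>M {1..} (\<lambda>_. borel)) (\<lambda>\<omega>. \<lambda>n\<in>{1..}. X n \<omega>)"
    and eps_indep: "prob_space.indep_vars M (\<lambda>_. borel) \<epsilon> {1..}"
    and eps_ident: "\<And>n. n \<ge> 1 \<Longrightarrow> distr M borel (\<epsilon> n) = distr M borel (\<epsilon> 1)"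
    and eps_sq_int: "\<And>n. n \<ge> 1 \<Longrightarrow> integrable M (\<lambda>\<omega>. (\<epsilon> n \<omega>)\<^sup>2)"
    and eps_mean: "\<And>n. n \<ge> 1 \<Longrightarrow> prob_space.expectation M (\<epsilon> n) = 0"
    and eps_var: "\<And>n. n \<ge> 1 \<Longrightarrow> prob_space.expectation M (\<lambda>\<omega>. (\<epsilon> n \<omega>)\<^sup>2) = \<sigma>\<^sup>2"
    and bandwidth: "\<And>n. n \<ge> 1 \<Longrightarrow> h n = real n powr (- \<alpha>)"
    and alpha: "0 < \<alpha>" "\<alpha> < 1 / 3"
    and gx: "g x > 0"
  shows "(AE \<omega> in M. (\<lambda>n. f_hat' K h (\<lambda>k. X k \<omega>) (\<lambda>k. Y k \<omega>) n x) \<longlonglongrightarrow> deriv f x) \<and>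
         (AE \<omega> in M. (\<lambda>n. f_tilde' g K h (\<lambda>k. X k \<omega>) (\<lambda>k. Y k \<omega>) n x) \<longlonglongrightarrow> deriv f x) \<and>
         (AE \<omega> in M. (\<lambda>n. f_check' g K h (\<lambda>k. X k \<omega>) (\<lambda>k. Y k \<omega>) n x) \<longlonglongrightarrow> deriv f x)"
proof -

  \<comment> \<open>Bounds, measurability and derivatives drawn from the hypotheses\<close>
  have f_meas: "f \<in> borel_measurable borel"
    and f_diff: "(f has_real_derivative deriv f u) (at u)" for u
    using f_smooth unfolding bounded_twice_differentiable_def
    by (auto intro: borel_measurable_continuous_onI simp: DERIV_deriv_iff_real_differentiable)
  have g_meas: "g \<in> borel_measurable borel"
    and g_diff: "(g has_real_derivative deriv g u) (at u)" for u
    using g_smooth unfolding bounded_twice_differentiable_def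
    by (auto intro: borel_measurable_continuous_onI simp: DERIV_deriv_iff_real_differentiable)
  obtain F where F: "\<And>u. \<bar>f u\<bar> \<le> F"
    using f_smooth unfolding bounded_twice_differentiable_def bounded_iff by auto
  obtain G where G: "\<And>u. \<bar>g u\<bar> \<le> G"
    using g_smooth unfolding bounded_twice_differentiable_def bounded_iff by auto
  have "bounded (range K)"
    using kernel unfolding admissible_kernel_def by blast
  then obtain A where A: "\<And>v. \<bar>K v\<bar> \<le> A"
    unfolding bounded_iff by auto
  have "bounded (range (deriv K))"
    using kernel unfolding admissible_kernel_def by blast
  then obtain A' where A': "\<And>v. \<bar>deriv K v\<bar> \<le> A'"
    unfolding bounded_iff by auto
  have K: "has_bochner_integral lborel K 1" and K': "has_bochner_integral lborel (deriv K) 0"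
    and vK': "has_bochner_integral lborel (\<lambda>v. v * deriv K v) (- 1)"
    and v4K': "integrable lborel (\<lambda>v. v ^ 4 * \<bar>deriv K v\<bar>)"
    using kernel unfolding admissible_kernel_def by auto
  have intK: "integrable lborel K" "integrable lborel (deriv K)"
    using K K' by (auto intro: integrable.intros)
  have [measurable]: "deriv K \<in> borel_measurable borel"
    using borel_measurable_integrable[OF intK(2)] by simp
  note [measurable] = f_meas g_meas

  interpret random_design M X \<epsilon> g h G \<sigma> \<alpha>
  proof (intro random_design.intro random_design_axioms.intro prob)
    show "g u \<le> G" for u using G[of u] by linarith
  qed fact+

  have K_lim: "(\<lambda>k. \<integral>u. \<psi> u * (K ((x - u) / h k) / h k ^ 1) \<partial>lborel) \<longlonglongrightarrow> \<psi> x"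
    if "\<psi> \<in> borel_measurable borel" "\<And>u. \<bar>\<psi> u\<bar> \<le> B" "isCont \<psi> x" for \<psi> B
    using kernel_smoothing_tendsto[OF that intK(1) h_pos h_tendsto_0] has_bochner_integral_integral_eq[OF K]
    by simp
  \<comment> \<open>The first moment -1 of \<open>deriv K\<close> cancels the sign in
    \<open>- d * m\<close>.\<close>
  have K'_lim: "(\<lambda>k. \<integral>u. \<psi> u * (deriv K ((x - u) / h k) / h k ^ 2) \<partial>lborel) \<longlonglongrightarrow> d"
    if "\<psi> \<in> borel_measurable borel" "\<And>u. \<bar>\<psi> u\<bar> \<le> B" "(\<psi> has_real_derivative d) (at x)" for \<psi> B d
    using kernel_derivative_smoothing_tendsto[OF that K' vK' h_pos h_tendsto_0] by simp

  have gf_bound: "\<bar>g u * f u\<bar> \<le> G * F" for u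
    unfolding abs_mult using G F order_trans[OF abs_ge_zero G] by (intro mult_mono) auto
  have gf_diff: "((\<lambda>u. g u * f u) has_real_derivative deriv g x * f x + deriv f x * g x) (at x)"
    by (rule DERIV_mult[OF g_diff f_diff])

  \<comment> \<open>The model equation holds only on \<open>space M\<close>; \<open>Z\<close> is its
    right-hand side at every sample point. Limits are proved for \<open>Z\<close> and carried over
    to \<open>Y\<close> through \<open>AE_space\<close>.\<close>
  define Z where "Z k \<omega> = f (X k \<omega>) + \<epsilon> k \<omega>" for k \<omega>
  have Y_eq: "Y k \<omega> = Z k \<omega>" if "\<omega> \<in> space M" "k \<ge> 1" for k \<omega>
    using model[OF that(2,1)] by (simp add: Z_def)

  \<comment> \<open>Almost sure limits of the four averages behind the quotient estimators\<close>
  have g_hat_AE: "AE \<omega> in M. (\<lambda>n. g_hat K h (\<lambda>k. X k \<omega>) n x) \<longlonglongrightarrow> g x"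
    using design_kernel_mean_AE[of "\<lambda>_. 1" 1 K A 1 x "g x", OF _ _ intK(1) A]
      K_lim[OF g_meas G DERIV_isCont[OF g_diff]]
    by (simp add: g_hat_def)
  have g_hat'_AE: "AE \<omega> in M. (\<lambda>n. g_hat' K h (\<lambda>k. X k \<omega>) n x) \<longlonglongrightarrow> deriv g x"
    using design_kernel_mean_AE[of "\<lambda>_. 1" 1 "deriv K" A' 2 x "deriv g x", OF _ _ intK(2) A']
      K'_lim[OF g_meas G g_diff]
    by (simp add: g_hat'_def)
  \<comment> \<open>The weight \<phi> is constantly 1 here, so the smoothed function is
    \<open>g * f\<close>; a nonconstant \<phi> occurs only for \<open>f_check'\<close>.\<close>
  have h_hat_AE: "AE \<omega> in M. (\<lambda>n. h_hat K h (\<lambda>k. X k \<omega>) (\<lambda>k. Z k \<omega>) n x) \<longlonglongrightarrow> g x * f x"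
    using response_kernel_mean_AE[of f F "\<lambda>_. 1" 1 K A 1 x "g x * f x", OF f_meas F _ _ intK(1) A]
      K_lim[OF _ gf_bound DERIV_isCont[OF gf_diff]]
    by (simp add: h_hat_def Z_def)
  have h_hat'_AE: "AE \<omega> in M. (\<lambda>n. h_hat' K h (\<lambda>k. X k \<omega>) (\<lambda>k. Z k \<omega>) n x)
      \<longlonglongrightarrow> deriv g x * f x + deriv f x * g x"
    using response_kernel_mean_AE[of f F "\<lambda>_. 1" 1 "deriv K" A' 2 x, OF f_meas F _ _ intK(2) A']
      K'_lim[OF _ gf_bound gf_diff]
    by (simp add: h_hat'_def Z_def)

  \<comment> \<open>The quotient estimators \<open>f_hat'\<close> and
    \<open>f_tilde'\<close>\<close>
  have f_hat'_AE: "AE \<omega> in M. (\<lambda>n. f_hat' K h (\<lambda>k. X k \<omega>) (\<lambda>k. Y k \<omega>) n x) \<longlonglongrightarrow> deriv f x"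
    using g_hat_AE g_hat'_AE h_hat_AE h_hat'_AE AE_space
  proof eventually_elim
    case (elim \<omega>)
    have "f_hat' K h (\<lambda>k. X k \<omega>) (\<lambda>k. Y k \<omega>) n x = f_hat' K h (\<lambda>k. X k \<omega>) (\<lambda>k. Z k \<omega>) n x" for n
      using Y_eq[OF elim(5)] by (simp add: f_hat'_def h_hat_def h_hat'_def)
    moreover have "(\<lambda>n. f_hat' K h (\<lambda>k. X k \<omega>) (\<lambda>k. Z k \<omega>) n x) \<longlonglongrightarrow>
        (deriv g x * f x + deriv f x * g x) / g x - (g x * f x) * deriv g x / (g x)\<^sup>2"
      unfolding f_hat'_def by (intro tendsto_intros elim) (use gx in auto)
    \<comment> \<open>This is the quotient rule for \<open>(g * f) / g\<close> at
      \<open>x\<close>.\<close>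
    moreover have "(deriv g x * f x + deriv f x * g x) / g x - (g x * f x) * deriv g x / (g x)\<^sup>2 = deriv f x"
      using gx by (simp add: field_simps power2_eq_square)
    ultimately show ?case by simp
  qed
  have f_tilde'_AE: "AE \<omega> in M. (\<lambda>n. f_tilde' g K h (\<lambda>k. X k \<omega>) (\<lambda>k. Y k \<omega>) n x) \<longlonglongrightarrow> deriv f x"
    using h_hat_AE h_hat'_AE AE_space
  proof eventually_elim
    case (elim \<omega>)
    have "f_tilde' g K h (\<lambda>k. X k \<omega>) (\<lambda>k. Y k \<omega>) n x = f_tilde' g K h (\<lambda>k. X k \<omega>) (\<lambda>k. Z k \<omega>) n x" for n
      using Y_eq[OF elim(3)] by (simp add: f_tilde'_def h_hat_def h_hat'_def)
    moreover have "(\<lambda>n. f_tilde' g K h (\<lambda>k. X k \<omega>) (\<lambda>k. Z k \<omega>) n x) \<longlonglongrightarrow>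
        (deriv g x * f x + deriv f x * g x) / g x - (g x * f x) * deriv g x / (g x)\<^sup>2"
      unfolding f_tilde'_def by (intro tendsto_intros elim) (use gx in auto)
    moreover have "(deriv g x * f x + deriv f x * g x) / g x - (g x * f x) * deriv g x / (g x)\<^sup>2 = deriv f x"
      using gx by (simp add: field_simps power2_eq_square)
    ultimately show ?case by simp
  qed

  \<comment> \<open>The estimator \<open>f_check'\<close>, split near and far from
    \<open>x\<close>\<close>
  have "(g \<longlongrightarrow> g x) (nhds x)"
    using DERIV_isCont[OF g_diff, of x] by (simp add: isCont_def tendsto_at_iff_tendsto_nhds)
  then have "\<forall>\<^sub>F u in nhds x. g u > g x / 2"
    using gx by (intro order_tendstoD(1)) auto
  then obtain \<delta> where \<delta>: "\<delta> > 0" "\<And>u. \<bar>u - x\<bar> < \<delta> \<Longrightarrow> g u > g x / 2"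
    by (auto simp: eventually_nhds_metric dist_real_def)
  text \<open>Since \<open>1 / g\<close> need not be bounded, \<open>f_check'\<close> is split at distance \<open>\<delta>\<close> from \<open>x\<close>:
    the far summands may have infinite variance and are controlled by their first moments.\<close>
  define \<phi> where "\<phi> u = (if \<bar>u - x\<bar> < \<delta> then 1 / g u else 0)" for u
  define w where "w k u = (if \<bar>u - x\<bar> < \<delta> then 0 else 1 / g u * (deriv K ((x - u) / h k) / h k ^ 2))" for k u
  have [measurable]: "\<phi> \<in> borel_measurable borel" "w k \<in> borel_measurable borel" for k
    unfolding \<phi>_def[abs_def] w_def[abs_def] by measurable
  have \<phi>_bound: "\<bar>\<phi> u\<bar> \<le> 2 / g x" for u
  proof (cases "\<bar>u - x\<bar> < \<delta>")
    case True
    then have "g x / 2 < g u" by (rule \<delta>(2))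
    then have "1 / g u \<le> 1 / (g x / 2)" using gx by (intro divide_left_mono) auto
    then show ?thesis using True g_nonneg[of u] by (simp add: \<phi>_def)
  qed (use gx in \<open>simp add: \<phi>_def\<close>)
  \<comment> \<open>The density cancels \<open>1 / g\<close> near \<open>x\<close>, so the smoothed
    function is \<open>f\<close> cut off at distance \<delta>: bounded, and with the derivative of
    \<open>f\<close> at \<open>x\<close> because differentiation is local.\<close>
  have near_eq: "g u * (f u * \<phi> u) = (if \<bar>u - x\<bar> < \<delta> then f u else 0)" for u
    using \<delta>(2)[of u] gx by (auto simp: \<phi>_def)
  have near_bound: "\<bar>g u * (f u * \<phi> u)\<bar> \<le> F" for u
    using F[of u] order_trans[OF abs_ge_zero F] by (simp add: near_eq)
  have near_diff: "((\<lambda>u. g u * (f u * \<phi> u)) has_real_derivative deriv f x) (at x)"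
  proof (rule DERIV_cong_ev[THEN iffD2, OF refl _ refl f_diff])
    have "\<forall>\<^sub>F u in nhds x. dist u x < \<delta>" using \<delta>(1) by (auto simp: eventually_nhds_metric)
    then show "\<forall>\<^sub>F u in nhds x. g u * (f u * \<phi> u) = f u"
      by eventually_elim (simp add: near_eq dist_real_def)
  qed
  have near_AE: "AE \<omega> in M. (\<lambda>n. (1 / real n) * (\<Sum>k=1..n. (f (X k \<omega>) + \<epsilon> k \<omega>) *
      (\<phi> (X k \<omega>) * (deriv K ((x - X k \<omega>) / h k) / h k ^ 2)))) \<longlonglongrightarrow> deriv f x"
    by (rule response_kernel_mean_AE[OF f_meas F _ \<phi>_bound intK(2) A' order_refl
          K'_lim[OF _ near_bound near_diff]]) measurable
  have far_AE: "AE \<omega> in M. (\<lambda>n. (1 / real n) *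
      (\<Sum>k=1..n. (f (X k \<omega>) + \<epsilon> k \<omega>) * w k (X k \<omega>))) \<longlonglongrightarrow> 0"
  proof (rule far_mean_tendsto_0_AE[OF f_meas F _ _ v4K' \<delta>(1)])
    \<comment> \<open>Where \<open>g u\<close> vanishes the product is 0; elsewhere
      \<open>g u\<close> cancels and leaves the bare kernel weight.\<close>
    show "\<bar>g u * w k u\<bar> \<le> (if \<bar>u - x\<bar> < \<delta> then 0 else \<bar>deriv K ((x - u) / h k)\<bar> / (h k)\<^sup>2)" for k u
      by (cases "g u = 0") (auto simp: w_def abs_mult)
  qed measurable
  have f_check'_AE: "AE \<omega> in M. (\<lambda>n. f_check' g K h (\<lambda>k. X k \<omega>) (\<lambda>k. Y k \<omega>) n x) \<longlonglongrightarrow> deriv f x"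
    using near_AE far_AE AE_space
  proof eventually_elim
    case (elim \<omega>)
    let ?X = "\<lambda>k. X k \<omega>" and ?l = "\<lambda>k. deriv K ((x - X k \<omega>) / h k) / h k ^ 2"
    \<comment> \<open>Exactly one of the two summands is active, according to the distance of the
      design point from \<open>x\<close>; points with \<open>g = 0\<close> give 0 on both sides by
      the convention on division.\<close>
    have split: "Y k \<omega> / (g (?X k) * (h k)\<^sup>2) * deriv K ((x - ?X k) / h k) =
        Z k \<omega> * (\<phi> (?X k) * ?l k) + Z k \<omega> * w k (?X k)" if "k \<ge> 1" for k
      using Y_eq[OF elim(3) that] by (simp add: \<phi>_def w_def)
    have "f_check' g K h ?X (\<lambda>k. Y k \<omega>) n x =
        (1 / real n) * (\<Sum>k=1..n. Z k \<omega> * (\<phi> (?X k) * ?l k)) + (1 / real n) * (\<Sum>k=1..n. Z k \<omega> * w k (?X k))" for n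
    proof -
      have "(\<Sum>k=1..n. Y k \<omega> / (g (?X k) * (h k)\<^sup>2) * deriv K ((x - ?X k) / h k)) =
          (\<Sum>k=1..n. Z k \<omega> * (\<phi> (?X k) * ?l k) + Z k \<omega> * w k (?X k))"
        by (intro sum.cong refl split) simp
      then show ?thesis unfolding f_check'_def by (simp only: sum.distrib distrib_left)
    qed
    then show ?case
      using tendsto_add[OF elim(1,2)] by (simp add: Z_def)
  qed
  show ?thesis using f_hat'_AE f_tilde'_AE f_check'_AE by blast
qed

end
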